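(* Let $\Bbbk$ be a unital commutative ring not of characteristic two, and let $\mathsf{P}$ be the (linearized) species of partitions with its cosymmetric $\mathsf{E}$-bicomodule structure. The cohomology group $H^0(\mathsf{P})$ is free of rank one over $\Bbbk$, and $H^1(\mathsf{P})$ is free of rank one generated by the (class of the) cardinality cocycle $\kappa:\mathsf{P}\to\mathsf{E}$, $\kappa(I)(z)=|I|e_I$. In fact, the inclusion $\mathsf{E}\to\mathsf{P}$ induces an isomorphism of commutative algebras $K^*(\mathsf{P})\to K^*(\mathsf{E})$.
   Context: A (linear) species is a functor from finite sets and bijections to $\Bbbk$-modules; $\mathsf{X}[n]$ is its value on $[n]=\{1,\ldots,n\}$. The Cauchy product is $(\mathsf{X}\cdot\mathsf{Y})[I]=\bigoplus_{(S,T)}\mathsf{X}[S]\otimes\mathsf{Y}[T]$ over decompositions (ordered tuples of disjoint, possibly empty, subsets with union $I$). $\mathsf{E}[I]=\Bbbk e_I$ is the exponential species, with coproduct $e_I\mapsto e_S\otimes e_T$. A cosymmetric $\mathsf{E}$-bicomodule is a species $\mathsf{X}$ with restriction maps $\mathsf{X}[I]\to\mathsf{X}[S]$, $z\mapsto z|_S$, for $S\subseteq I$, functorial in $S$ and natural for bijections, with coactions $\lambda(z)=\sum e_S\otimes z|_T$, $\rho(z)=\sum z|_S\otimes e_T$. $\mathsf{E}$ itself is one with $e_I|_S=e_S$. $\mathsf{P}[I]$ is free on the set of partitions of $I$ (sets of disjoint nonempty subsets with union $I$), and $X|_S=\{x\cap S:x\in X\}\setminus\{\varnothing\}$. The inclusion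 $\mathsf{E}\to\mathsf{P}$ sends $e_I$ to the one-block partition of $I$ (the empty partition if $I=\varnothing$). $C^n(\mathsf{X})=\operatorname{Hom}(\mathsf{X},\mathsf{E}^{\cdot n})$; a cochain is given by coefficients $\alpha(F_1,\ldots,F_n)(z)\in\Bbbk$, for $(F_1,\ldots,F_n)$ a decomposition of $I$ and $z\in\mathsf{X}[I]$. $\delta=\sum_{i=0}^{n+1}(-1)^id^i$ with $(d^0\alpha)(F_0,\ldots,F_n)(z)=\alpha(F_1,\ldots,F_n)(z|_{F_0^c})$, $(d^i\alpha)(F_0,\ldots,F_n)(z)=\alpha(F_0,\ldots,F_{i-1}\cup F_i,\ldots,F_n)(z)$ for $0<i<n+1$, $(d^{n+1}\alpha)(F_0,\ldots,F_n)(z)=\alpha(F_0,\ldots,F_{n-1})(z|_{F_n^c})$. $H^*(\mathsf{X})$ is the cohomology of $(C^*(\mathsf{X}),\delta)$. For a cosymmetric bicomodule linearized from a set species, the Koszul complex $K^p(\mathsf{X})=\operatorname{Hom}_{S_p}(\mathsf{X}[p],\operatorname{sgn}_p)$ ($\operatorname{sgn}_p$ the sign representation) has zero differential, and is an algebra with $(f\smile g)(z)=\sum_{(S,T)}(-1)^{\operatorname{sch}(S,T)}f(\lambda_S(z|_S))g(\lambda_T(z|_T))$ for basis elements $z\in\mathsf{X}[p+q]$, over decompositions of $[p+q]$ with $\#S=p$, $\#T=q$; $\lambda_S:S\to[p]$, $\lambda_T:T\to[q]$ are the order-preserving bijections and $\operatorname{sch}(S,T)=\#\{(s,t)\in S\times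 T:s>t\}$.
   Formalization: The isomorphism K*(P) → K*(E) is stated only for rings in which 2a = 0 implies a = 0; with "not of characteristic two" alone it fails, e.g. over Z/4, where K²(P) → K²(E) is not injective. *)

theory Defs
  imports "HOL-Algebra.Algebra" "HOL-Library.Disjoint_Sets" "HOL-Combinatorics.Permutations"
begin

text \<open>
  The base ring is a commutative ring \<open>K\<close> in the sense of HOL-Algebra. Finite sets are finite sets
  of natural numbers: they form a category equivalent to that of all finite sets and bijections,
  closed under subsets and containing all \<open>{1..n}\<close>. A bijection out of \<open>I\<close> is given by a function
  \<open>\<sigma>\<close> injective on \<open>I\<close>, with target \<open>\<sigma> ` I\<close>.
\<close>

section \<open>The base ring, free and quotient modules\<close>

text \<open>The additive order of the unit; as usual for \<open>ord\<close>, it is \<open>0\<close> if that order is infinite.\<close>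

definition ring_char :: "('k, 's) ring_scheme \<Rightarrow> nat" where
  "ring_char K = group.ord (add_monoid K) \<one>\<^bsub>K\<^esub>"

definition linear_form :: "('k, 's) ring_scheme \<Rightarrow> ('k, 'm) module \<Rightarrow> ('m \<Rightarrow> 'k) \<Rightarrow> bool" where
  "linear_form K M f \<longleftrightarrow>
     f \<in> carrier M \<rightarrow> carrier K \<and>
     (\<forall>x\<in>carrier M. \<forall>y\<in>carrier M. f (x \<oplus>\<^bsub>M\<^esub> y) = f x \<oplus>\<^bsub>K\<^esub> f y) \<and>
     (\<forall>c\<in>carrier K. \<forall>x\<in>carrier M. f (c \<odot>\<^bsub>M\<^esub> x) = c \<otimes>\<^bsub>K\<^esub> f x)"

text \<open>The free module on \<open>B\<close>: finitely supported functions, zero outside \<open>B\<close>. In this and the other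
  module records below the ring fields \<open>monoid.mult\<close> and \<open>one\<close> are irrelevant.\<close>

definition free_module :: "('k, 's) ring_scheme \<Rightarrow> 'b set \<Rightarrow> ('k, 'b \<Rightarrow> 'k) module" where
  "free_module K B =
     \<lparr>carrier = {x. range x \<subseteq> carrier K \<and> finite {b. x b \<noteq> \<zero>\<^bsub>K\<^esub>} \<and> {b. x b \<noteq> \<zero>\<^bsub>K\<^esub>} \<subseteq> B},
      monoid.mult = undefined, one = undefined,
      ring.zero = (\<lambda>b. \<zero>\<^bsub>K\<^esub>), add = (\<lambda>x y b. x b \<oplus>\<^bsub>K\<^esub> y b),
      smult = (\<lambda>c x b. c \<otimes>\<^bsub>K\<^esub> x b)\<rparr>"

definition basis_vec :: "('k, 's) ring_scheme \<Rightarrow> 'b \<Rightarrow> 'b \<Rightarrow> 'k" where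
  "basis_vec K b = (\<lambda>c. if c = b then \<one>\<^bsub>K\<^esub> else \<zero>\<^bsub>K\<^esub>)"

text \<open>\<open>lin_push K h\<close> and \<open>lin_ext K \<phi>\<close> are the linear extensions of a map \<open>h\<close> between bases and of a
  \<open>K\<close>-valued function \<open>\<phi>\<close> on a basis.\<close>

definition lin_push :: "('k, 's) ring_scheme \<Rightarrow> ('b \<Rightarrow> 'c) \<Rightarrow> ('b \<Rightarrow> 'k) \<Rightarrow> 'c \<Rightarrow> 'k" where
  "lin_push K h x = (\<lambda>c. \<Oplus>\<^bsub>K\<^esub>b\<in>{b. x b \<noteq> \<zero>\<^bsub>K\<^esub> \<and> h b = c}. x b)"

definition lin_ext :: "('k, 's) ring_scheme \<Rightarrow> ('b \<Rightarrow> 'k) \<Rightarrow> ('b \<Rightarrow> 'k) \<Rightarrow> 'k" where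
  "lin_ext K \<phi> x = (\<Oplus>\<^bsub>K\<^esub>b\<in>{b. x b \<noteq> \<zero>\<^bsub>K\<^esub>}. x b \<otimes>\<^bsub>K\<^esub> \<phi> b)"

definition quotient_module :: "('k, 'm) module \<Rightarrow> 'm set \<Rightarrow> ('k, 'm set) module" where
  "quotient_module M N =
     \<lparr>carrier = a_rcosets\<^bsub>M\<^esub> N, monoid.mult = undefined, one = undefined,
      ring.zero = N, add = (\<lambda>A B. A <+>\<^bsub>M\<^esub> B),
      smult = (\<lambda>c A. \<Union>x\<in>A. N +>\<^bsub>M\<^esub> (c \<odot>\<^bsub>M\<^esub> x))\<rparr>"

definition free_rank_one_on :: "('k, 's) ring_scheme \<Rightarrow> ('k, 'm) module \<Rightarrow> 'm \<Rightarrow> bool" where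
  "free_rank_one_on K M g \<longleftrightarrow>
     module K M \<and> g \<in> carrier M \<and>
     (\<forall>x\<in>carrier M. \<exists>!c. c \<in> carrier K \<and> x = c \<odot>\<^bsub>M\<^esub> g)"

section \<open>Species with restrictions\<close>

record 'b set_species =
  ss_elems :: "nat set \<Rightarrow> 'b set"
  ss_map :: "nat set \<Rightarrow> (nat \<Rightarrow> nat) \<Rightarrow> 'b \<Rightarrow> 'b"
  ss_res :: "nat set \<Rightarrow> nat set \<Rightarrow> 'b \<Rightarrow> 'b"

text \<open>\<open>ss_map Y I \<sigma>\<close> is the map \<open>Y[I] \<rightarrow> Y[\<sigma> ` I]\<close>, and \<open>ss_res Y I S\<close> the restriction \<open>Y[I] \<rightarrow> Y[S]\<close>.\<close>

locale cosymmetric_set_species =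
  fixes Y :: "'b set_species"
  assumes map_closed: "\<lbrakk>finite I; inj_on \<sigma> I; z \<in> ss_elems Y I\<rbrakk> \<Longrightarrow> ss_map Y I \<sigma> z \<in> ss_elems Y (\<sigma> ` I)"
    and map_cong: "\<lbrakk>finite I; inj_on \<sigma> I; z \<in> ss_elems Y I; \<And>i. i \<in> I \<Longrightarrow> \<sigma> i = \<tau> i\<rbrakk>
          \<Longrightarrow> ss_map Y I \<sigma> z = ss_map Y I \<tau> z"
    and map_id: "\<lbrakk>finite I; z \<in> ss_elems Y I\<rbrakk> \<Longrightarrow> ss_map Y I id z = z"
    and map_comp: "\<lbrakk>finite I; inj_on \<sigma> I; inj_on \<tau> (\<sigma> ` I); z \<in> ss_elems Y I\<rbrakk>
          \<Longrightarrow> ss_map Y (\<sigma> ` I) \<tau> (ss_map Y I \<sigma> z) = ss_map Y I (\<tau> \<circ> \<sigma>) z"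
    and res_closed: "\<lbrakk>finite I; S \<subseteq> I; z \<in> ss_elems Y I\<rbrakk> \<Longrightarrow> ss_res Y I S z \<in> ss_elems Y S"
    and res_self: "\<lbrakk>finite I; z \<in> ss_elems Y I\<rbrakk> \<Longrightarrow> ss_res Y I I z = z"
    and res_res: "\<lbrakk>finite I; S \<subseteq> I; T \<subseteq> S; z \<in> ss_elems Y I\<rbrakk>
          \<Longrightarrow> ss_res Y S T (ss_res Y I S z) = ss_res Y I T z"
    and res_map: "\<lbrakk>finite I; S \<subseteq> I; inj_on \<sigma> I; z \<in> ss_elems Y I\<rbrakk>
          \<Longrightarrow> ss_res Y (\<sigma> ` I) (\<sigma> ` S) (ss_map Y I \<sigma> z) = ss_map Y S \<sigma> (ss_res Y I S z)"

text \<open>In \<open>exp_species\<close> the unit element encodes \<open>e\<^sub>I\<close>, for every \<open>I\<close>.\<close>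

definition exp_species :: "unit set_species" where
  "exp_species = \<lparr>ss_elems = (\<lambda>I. UNIV), ss_map = (\<lambda>I \<sigma> z. z), ss_res = (\<lambda>I S z. z)\<rparr>"

definition partition_species :: "nat set set set_species" where
  "partition_species =
     \<lparr>ss_elems = (\<lambda>I. {z. partition_on I z}),
      ss_map = (\<lambda>I \<sigma> z. (`) \<sigma> ` z),
      ss_res = (\<lambda>I S z. (\<lambda>x. x \<inter> S) ` z - {{}})\<rparr>"

lemma cosymmetric_exp_species: "cosymmetric_set_species exp_species"
  by unfold_locales (simp_all add: exp_species_def)

lemma cosymmetric_partition_species: "cosymmetric_set_species partition_species"
proof (unfold_locales, goal_cases)
  case (1 I \<sigma> z)
  then have z: "partition_on I z" by (simp add: partition_species_def)
  have "\<sigma> ` x \<inter> \<sigma> ` y = {}" if "x \<in> z" "y \<in> z" "x \<noteq> y" for x y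
  proof -
    have "x \<subseteq> I" "y \<subseteq> I" "x \<inter> y = {}"
      using z that unfolding partition_on_def disjoint_def by auto
    then show ?thesis using inj_on_image_Int[OF \<open>inj_on \<sigma> I\<close>, of x y] by simp
  qed
  then have "partition_on (\<sigma> ` I) ((`) \<sigma> ` z)"
    using z unfolding partition_on_def disjoint_def by auto
  then show ?case by (simp add: partition_species_def)
next
  case (2 I \<sigma> z \<tau>)
  have "\<sigma> ` x = \<tau> ` x" if "x \<in> z" for x
    using 2 that by (intro image_cong) (auto simp: partition_species_def partition_on_def)
  then have "(`) \<sigma> ` z = (`) \<tau> ` z" by (rule image_cong[OF refl])
  then show ?case by (simp add: partition_species_def)
next
  case (3 I z)
  then show ?case by (simp add: partition_species_def)
next
  case (4 I \<sigma> \<tau> z)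
  then show ?case by (simp add: partition_species_def image_image comp_def)
next
  case (5 I S z)
  then have z: "partition_on I z" and "S \<inter> I = S" by (auto simp: partition_species_def)
  have "(\<inter>) S = (\<lambda>x. x \<inter> S)" by (rule ext) (rule Int_commute)
  then have "partition_on S ((\<lambda>x. x \<inter> S) ` z - {{}})"
    using partition_on_restrict[OF z, of S] \<open>S \<inter> I = S\<close> by simp
  then show ?case by (simp add: partition_species_def)
next
  case (6 I z)
  then have "x \<inter> I = x" if "x \<in> z" for x
    using that by (auto simp: partition_species_def partition_on_def)
  then have "(\<lambda>x. x \<inter> I) ` z = z" by simp
  with 6 show ?case by (auto simp: partition_species_def partition_on_def)
next
  case (7 I S T z)
  then have ST: "S \<inter> T = T" by blast
  have "(\<lambda>x. x \<inter> T) ` (A - {{}}) - {{}} = (\<lambda>x. x \<inter> T) ` A - {{}}" for A :: "nat set set"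
    by blast
  then have "(\<lambda>x. x \<inter> T) ` ((\<lambda>x. x \<inter> S) ` z - {{}}) - {{}} = (\<lambda>x. x \<inter> T) ` (\<lambda>x. x \<inter> S) ` z - {{}}" .
  also have "(\<lambda>x. x \<inter> T) ` (\<lambda>x. x \<inter> S) ` z = (\<lambda>x. x \<inter> T) ` z"
    by (simp only: image_image Int_assoc ST)
  finally show ?case by (simp add: partition_species_def)
next
  case (8 I S \<sigma> z)
  have "\<sigma> ` x \<inter> \<sigma> ` S = \<sigma> ` (x \<inter> S)" if "x \<in> z" for x
  proof -
    have "x \<subseteq> I" using 8 that by (auto simp: partition_species_def partition_on_def)
    then show ?thesis using inj_on_image_Int[OF \<open>inj_on \<sigma> I\<close>, of x S] 8 by simp
  qed
  then have "(\<lambda>y. y \<inter> \<sigma> ` S) ` (`) \<sigma> ` z = (`) \<sigma> ` (\<lambda>x. x \<inter> S) ` z"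
    unfolding image_image by (rule image_cong[OF refl])
  moreover have "(`) \<sigma> ` A - {{}} = (`) \<sigma> ` (A - {{}})" for A :: "nat set set"
    by blast
  ultimately show ?case by (simp add: partition_species_def)
qed

text \<open>The empty set has the empty partition only, hence the subtraction.\<close>

definition one_block :: "nat set \<Rightarrow> unit \<Rightarrow> nat set set" where
  "one_block I e = {I} - {{}}"

section \<open>Linear bicomodules and linearization\<close>

text \<open>Restrictions determine the two coactions \<open>z \<mapsto> \<Sum> e\<^sub>S \<otimes> z|\<^sub>T\<close> and \<open>z \<mapsto> \<Sum> z|\<^sub>S \<otimes> e\<^sub>T\<close>, so they are
  what is recorded.\<close>

record ('k, 'm) bicomodule =
  bc_mod :: "nat set \<Rightarrow> ('k, 'm) module"
  bc_map :: "nat set \<Rightarrow> (nat \<Rightarrow> nat) \<Rightarrow> 'm \<Rightarrow> 'm"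
  bc_res :: "nat set \<Rightarrow> nat set \<Rightarrow> 'm \<Rightarrow> 'm"

definition linearize :: "('k, 's) ring_scheme \<Rightarrow> 'b set_species \<Rightarrow> ('k, 'b \<Rightarrow> 'k) bicomodule" where
  "linearize K Y =
     \<lparr>bc_mod = (\<lambda>I. free_module K (ss_elems Y I)),
      bc_map = (\<lambda>I \<sigma>. lin_push K (ss_map Y I \<sigma>)),
      bc_res = (\<lambda>I S. lin_push K (ss_res Y I S))\<rparr>"

section \<open>The cochain complex\<close>

definition decompositions :: "nat \<Rightarrow> nat set list set" where
  "decompositions n =
     {F. length F = n \<and> finite (\<Union>(set F)) \<and> disjoint_family_on (\<lambda>i. F ! i) {..<n}}"

text \<open>A cochain \<open>\<alpha>: Y \<rightarrow> E\<^sup>n\<close> (Cauchy power) is given by its coefficients \<open>\<alpha> F z\<close>, with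
  \<open>F = [F\<^sub>1, \<dots>, F\<^sub>n]\<close> a decomposition of some \<open>I\<close> and \<open>z \<in> Y[I]\<close>. To make the coefficient family
  unique it is required to vanish outside this domain.\<close>

definition cochains ::
  "('k, 's) ring_scheme \<Rightarrow> ('k, 'm) bicomodule \<Rightarrow> nat \<Rightarrow> ('k, nat set list \<Rightarrow> 'm \<Rightarrow> 'k) module" where
  "cochains K Y n =
     \<lparr>carrier = {\<alpha>.
        (\<forall>F\<in>decompositions n. linear_form K (bc_mod Y (\<Union>(set F))) (\<alpha> F)) \<and>
        (\<forall>F\<in>decompositions n. \<forall>\<sigma>. inj_on \<sigma> (\<Union>(set F)) \<longrightarrow>
           (\<forall>z\<in>carrier (bc_mod Y (\<Union>(set F))).
              \<alpha> (map ((`) \<sigma>) F) (bc_map Y (\<Union>(set F)) \<sigma> z) = \<alpha> F z)) \<and>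
        (\<forall>F z. \<not> (F \<in> decompositions n \<and> z \<in> carrier (bc_mod Y (\<Union>(set F)))) \<longrightarrow> \<alpha> F z = \<zero>\<^bsub>K\<^esub>)},
      monoid.mult = undefined, one = undefined,
      ring.zero = (\<lambda>F z. \<zero>\<^bsub>K\<^esub>), add = (\<lambda>\<alpha> \<beta> F z. \<alpha> F z \<oplus>\<^bsub>K\<^esub> \<beta> F z),
      smult = (\<lambda>c \<alpha> F z. c \<otimes>\<^bsub>K\<^esub> \<alpha> F z)\<rparr>"

text \<open>\<open>coface K Y n i\<close> is \<open>d\<^sup>i\<close> on \<open>n\<close>-cochains, \<open>0 \<le> i \<le> n + 1\<close>; in \<open>F = [F\<^sub>0, \<dots>, F\<^sub>n]\<close> the list
  index coincides with the index of the block.\<close>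

definition coface ::
  "('k, 's) ring_scheme \<Rightarrow> ('k, 'm) bicomodule \<Rightarrow> nat \<Rightarrow> nat
     \<Rightarrow> (nat set list \<Rightarrow> 'm \<Rightarrow> 'k) \<Rightarrow> nat set list \<Rightarrow> 'm \<Rightarrow> 'k" where
  "coface K Y n i \<alpha> F z =
     (let I = \<Union>(set F) in
      if F \<in> decompositions (Suc n) \<and> z \<in> carrier (bc_mod Y I) then
        if i = 0 then \<alpha> (tl F) (bc_res Y I (I - hd F) z)
        else if i = Suc n then \<alpha> (butlast F) (bc_res Y I (I - last F) z)
        else \<alpha> (take (i - 1) F @ (F ! (i - 1) \<union> F ! i) # drop (Suc i) F) z
      else \<zero>\<^bsub>K\<^esub>)"

definition coboundary ::
  "('k, 's) ring_scheme \<Rightarrow> ('k, 'm) bicomodule \<Rightarrow> nat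
     \<Rightarrow> (nat set list \<Rightarrow> 'm \<Rightarrow> 'k) \<Rightarrow> nat set list \<Rightarrow> 'm \<Rightarrow> 'k" where
  "coboundary K Y n \<alpha> F z =
     (\<Oplus>\<^bsub>K\<^esub>i\<in>{0..Suc n}. ((\<ominus>\<^bsub>K\<^esub> \<one>\<^bsub>K\<^esub>) [^]\<^bsub>K\<^esub> i) \<otimes>\<^bsub>K\<^esub> coface K Y n i \<alpha> F z)"

definition cocycles ::
  "('k, 's) ring_scheme \<Rightarrow> ('k, 'm) bicomodule \<Rightarrow> nat \<Rightarrow> (nat set list \<Rightarrow> 'm \<Rightarrow> 'k) set" where
  "cocycles K Y n =
     {\<alpha> \<in> carrier (cochains K Y n). coboundary K Y n \<alpha> = \<zero>\<^bsub>cochains K Y (Suc n)\<^esub>}"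

definition coboundaries ::
  "('k, 's) ring_scheme \<Rightarrow> ('k, 'm) bicomodule \<Rightarrow> nat \<Rightarrow> (nat set list \<Rightarrow> 'm \<Rightarrow> 'k) set" where
  "coboundaries K Y n =
     (case n of 0 \<Rightarrow> {\<zero>\<^bsub>cochains K Y 0\<^esub>}
      | Suc m \<Rightarrow> coboundary K Y m ` carrier (cochains K Y m))"

definition cohomology ::
  "('k, 's) ring_scheme \<Rightarrow> ('k, 'm) bicomodule \<Rightarrow> nat
     \<Rightarrow> ('k, (nat set list \<Rightarrow> 'm \<Rightarrow> 'k) set) module" where
  "cohomology K Y n =
     quotient_module ((cochains K Y n)\<lparr>carrier := cocycles K Y n\<rparr>) (coboundaries K Y n)"

definition cohomology_class ::
  "('k, 's) ring_scheme \<Rightarrow> ('k, 'm) bicomodule \<Rightarrow> nat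
     \<Rightarrow> (nat set list \<Rightarrow> 'm \<Rightarrow> 'k) \<Rightarrow> (nat set list \<Rightarrow> 'm \<Rightarrow> 'k) set" where
  "cohomology_class K Y n \<alpha> = coboundaries K Y n +>\<^bsub>cochains K Y n\<^esub> \<alpha>"

text \<open>The linear extension of \<open>z \<mapsto> |I| e\<^sub>I\<close>, \<open>z\<close> a partition of \<open>I\<close>; its coefficient at the
  decomposition \<open>[I]\<close> of \<open>I\<close>.\<close>

definition cardinality_cochain ::
  "('k, 's) ring_scheme \<Rightarrow> nat set list \<Rightarrow> (nat set set \<Rightarrow> 'k) \<Rightarrow> 'k" where
  "cardinality_cochain K F x =
     (if F \<in> decompositions 1 \<and> x \<in> carrier (free_module K (ss_elems partition_species (\<Union>(set F))))
      then lin_ext K (\<lambda>z. [card (\<Union>(set F))] \<cdot>\<^bsub>K\<^esub> \<one>\<^bsub>K\<^esub>) x else \<zero>\<^bsub>K\<^esub>)"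

section \<open>The Koszul complex\<close>

definition koszul :: "('k, 's) ring_scheme \<Rightarrow> ('k, 'm) bicomodule \<Rightarrow> nat \<Rightarrow> ('m \<Rightarrow> 'k) set" where
  "koszul K Y p =
     {f. linear_form K (bc_mod Y {1..p}) f \<and>
         (\<forall>\<sigma>. \<sigma> permutes {1..p} \<longrightarrow>
            (\<forall>z\<in>carrier (bc_mod Y {1..p}). f (bc_map Y {1..p} \<sigma> z) = [sign \<sigma>] \<cdot>\<^bsub>K\<^esub> f z)) \<and>
         (\<forall>z. z \<notin> carrier (bc_mod Y {1..p}) \<longrightarrow> f z = \<zero>\<^bsub>K\<^esub>)}"

text \<open>On \<open>S\<close>, \<open>order_rank S\<close> is the order-preserving bijection onto \<open>{1..card S}\<close>.\<close>

definition order_rank :: "nat set \<Rightarrow> nat \<Rightarrow> nat" where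
  "order_rank S s = card {t \<in> S. t \<le> s}"

definition sch :: "nat set \<Rightarrow> nat set \<Rightarrow> nat" where
  "sch S T = card {(s, t). s \<in> S \<and> t \<in> T \<and> s > t}"

definition standardized_res :: "'b set_species \<Rightarrow> nat set \<Rightarrow> nat set \<Rightarrow> 'b \<Rightarrow> 'b" where
  "standardized_res Y I S z = ss_map Y S (order_rank S) (ss_res Y I S z)"

definition smile ::
  "('k, 's) ring_scheme \<Rightarrow> 'b set_species \<Rightarrow> nat \<Rightarrow> nat
     \<Rightarrow> (('b \<Rightarrow> 'k) \<Rightarrow> 'k) \<Rightarrow> (('b \<Rightarrow> 'k) \<Rightarrow> 'k) \<Rightarrow> ('b \<Rightarrow> 'k) \<Rightarrow> 'k" where
  "smile K Y p q f g x =
     (let I = {1..p + q} in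
      if x \<in> carrier (free_module K (ss_elems Y I)) then
        lin_ext K
          (\<lambda>z. \<Oplus>\<^bsub>K\<^esub>S\<in>{S. S \<subseteq> I \<and> card S = p}.
             ((\<ominus>\<^bsub>K\<^esub> \<one>\<^bsub>K\<^esub>) [^]\<^bsub>K\<^esub> sch S (I - S))
             \<otimes>\<^bsub>K\<^esub> (f (basis_vec K (standardized_res Y I S z))
               \<otimes>\<^bsub>K\<^esub> g (basis_vec K (standardized_res Y I (I - S) z)))) x
      else \<zero>\<^bsub>K\<^esub>)"

text \<open>\<open>K\<^sup>*\<close> is the direct sum of all \<open>K\<^sup>p\<close>: an element is a finitely supported family of components.
  The unit is the element of \<open>K\<^sup>0\<close> with value \<open>1\<close> on every basis element.\<close>

definition koszul_algebra ::
  "('k, 's) ring_scheme \<Rightarrow> 'b set_species \<Rightarrow> ('k, nat \<Rightarrow> ('b \<Rightarrow> 'k) \<Rightarrow> 'k) module" where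
  "koszul_algebra K Y =
     \<lparr>carrier = {f. (\<forall>p. f p \<in> koszul K (linearize K Y) p) \<and> finite {p. f p \<noteq> (\<lambda>x. \<zero>\<^bsub>K\<^esub>)}},
      monoid.mult = (\<lambda>f g n x. \<Oplus>\<^bsub>K\<^esub>p\<in>{0..n}. smile K Y p (n - p) (f p) (g (n - p)) x),
      one = (\<lambda>p x. if p = 0 \<and> x \<in> carrier (free_module K (ss_elems Y {}))
                   then lin_ext K (\<lambda>z. \<one>\<^bsub>K\<^esub>) x else \<zero>\<^bsub>K\<^esub>),
      ring.zero = (\<lambda>p x. \<zero>\<^bsub>K\<^esub>), add = (\<lambda>f g p x. f p x \<oplus>\<^bsub>K\<^esub> g p x),
      smult = (\<lambda>c f p x. c \<otimes>\<^bsub>K\<^esub> f p x)\<rparr>"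

definition graded_commutative :: "('k, 's) ring_scheme \<Rightarrow> 'b set_species \<Rightarrow> bool" where
  "graded_commutative K Y \<longleftrightarrow>
     (\<forall>p q. \<forall>f\<in>koszul K (linearize K Y) p. \<forall>g\<in>koszul K (linearize K Y) q.
        smile K Y p q f g
          = (\<lambda>x. ((\<ominus>\<^bsub>K\<^esub> \<one>\<^bsub>K\<^esub>) [^]\<^bsub>K\<^esub> (p * q)) \<otimes>\<^bsub>K\<^esub> smile K Y q p g f x))"

text \<open>The map \<open>K\<^sup>*(Z) \<rightarrow> K\<^sup>*(Y)\<close> induced by a morphism with components \<open>\<phi> I: Y[I] \<rightarrow> Z[I]\<close>, acting by
  precomposition in each degree.\<close>

definition koszul_pullback ::
  "('k, 's) ring_scheme \<Rightarrow> 'b set_species \<Rightarrow> (nat set \<Rightarrow> 'b \<Rightarrow> 'c)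
     \<Rightarrow> (nat \<Rightarrow> ('c \<Rightarrow> 'k) \<Rightarrow> 'k) \<Rightarrow> nat \<Rightarrow> ('b \<Rightarrow> 'k) \<Rightarrow> 'k" where
  "koszul_pullback K Y \<phi> f p x =
     (if x \<in> carrier (free_module K (ss_elems Y {1..p}))
      then f p (lin_push K (\<phi> {1..p}) x) else \<zero>\<^bsub>K\<^esub>)"

text \<open>The locale \<open>algebra\<close> of HOL-Algebra comprises commutativity.\<close>

definition comm_algebra_iso ::
  "('k, 's) ring_scheme \<Rightarrow> ('k, 'a) module \<Rightarrow> ('k, 'b) module \<Rightarrow> ('a \<Rightarrow> 'b) \<Rightarrow> bool" where
  "comm_algebra_iso K A B h \<longleftrightarrow>
     algebra K A \<and> algebra K B \<and> h \<in> ring_iso A B \<and>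
     (\<forall>c\<in>carrier K. \<forall>x\<in>carrier A. h (c \<odot>\<^bsub>A\<^esub> x) = c \<odot>\<^bsub>B\<^esub> h x)"

end

theory Submission
  imports Defs
begin

text \<open>
  In degree one, the cocycle condition says that
  \<open>\<alpha> [S \<union> T] z = \<alpha> [S] (z|\<^sub>S) + \<alpha> [T] (z|\<^sub>T)\<close> for all disjoint \<open>S\<close> and \<open>T\<close>
  (\<open>cocycle_1_iff_additive\<close>). A one-point set has a single partition, and by naturality \<open>\<alpha>\<close> takes the
  same value \<open>c\<close> on all of these; splitting off the points of \<open>I\<close> one at a time gives
  \<open>\<alpha> [I] z = |I| c\<close>, that is, \<open>\<alpha> = c \<kappa>\<close> (\<open>partition_cocycle_eq\<close>). In degree zero only the empty
  partition is involved. The coboundary of a \<open>0\<close>-cochain is a difference of two equal terms, so both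
  cohomology groups consist of cocycles, and the value \<open>1\<close> taken by the generator shows that they are
  free.

  In the Koszul complex, let \<open>f\<close> have degree \<open>p \<ge> 2\<close>. Every partition \<open>z\<close> of \<open>{1..p}\<close> is fixed by
  some transposition: exchange two points of the same block, or any two points if all blocks are
  singletons (\<open>partition_fixed_by_transposition\<close>). Therefore \<open>f z = - f z\<close>, and in the absence of
  two-torsion \<open>f z = 0\<close>. The exponential species has the same property. What remains are the
  degrees zero and one, with one basis structure each. The product in degrees up to one is the
  evident one, and the product of two elements of degree one vanishes. So for both species the
  algebra is that of dual numbers over the base ring, and the isomorphism induced by
  \<open>E \<rightarrow> P\<close> is the identity in these coordinates, because a set with at most one point has only
  one partition, which is therefore the image of the basis element of \<open>E\<close>. This argument is carried out once for all species with
  these two properties, in the locale \<open>transposition_fixed_species\<close>.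
\<close>

section \<open>Decompositions and partitions of small sets\<close>

lemma decompositions_0: "F \<in> decompositions 0 \<longleftrightarrow> F = []"
  by (auto simp: decompositions_def disjoint_family_on_def)

lemma decompositions_1: "F \<in> decompositions (Suc 0) \<longleftrightarrow> (\<exists>I. finite I \<and> F = [I])"
proof -
  have "[I] \<in> decompositions (Suc 0) \<longleftrightarrow> finite I" for I
    by (simp add: decompositions_def disjoint_family_on_def lessThan_Suc)
  moreover have "\<exists>I. F = [I]" if "F \<in> decompositions (Suc 0)"
    using that by (simp add: decompositions_def length_Suc_conv)
  ultimately show ?thesis by metis
qed

lemma decompositions_2:
  "F \<in> decompositions (Suc (Suc 0)) \<longleftrightarrow>
     (\<exists>S T. finite S \<and> finite T \<and> S \<inter> T = {} \<and> F = [S, T])"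
proof -
  have "[S, T] \<in> decompositions (Suc (Suc 0)) \<longleftrightarrow> finite S \<and> finite T \<and> S \<inter> T = {}" for S T
    by (simp add: decompositions_def disjoint_family_on_def lessThan_Suc) blast
  moreover have "\<exists>S T. F = [S, T]" if "F \<in> decompositions (Suc (Suc 0))"
    using that by (simp add: decompositions_def length_Suc_conv) blast
  ultimately show ?thesis by metis
qed

lemma partition_on_singleton: "partition_on {i} z \<longleftrightarrow> z = {{i}}"
proof
  assume z: "partition_on {i} z"
  then have "x = {i}" if "x \<in> z" for x
    using that unfolding partition_on_def by (metis Union_upper subset_singletonD)
  moreover have "z \<noteq> {}" using z by (auto simp: partition_on_def)
  ultimately show "z = {{i}}" by blast
qed (simp add: partition_on_def)

section \<open>Linear forms on free modules\<close>

context cring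
begin

lemma free_module_add [simp]: "x \<oplus>\<^bsub>free_module R B\<^esub> y = (\<lambda>b. x b \<oplus> y b)"
  and free_module_smult [simp]: "c \<odot>\<^bsub>free_module R B\<^esub> x = (\<lambda>b. c \<otimes> x b)"
  by (simp_all add: free_module_def)

lemma free_module_value: "x \<in> carrier (free_module R B) \<Longrightarrow> x b \<in> carrier R"
  and free_module_finite: "x \<in> carrier (free_module R B) \<Longrightarrow> finite {b. x b \<noteq> \<zero>}"
  and free_module_support: "x \<in> carrier (free_module R B) \<Longrightarrow> {b. x b \<noteq> \<zero>} \<subseteq> B"
  by (auto simp: free_module_def)

lemma free_module_memI:
  assumes "\<And>b. x b \<in> carrier R" "finite A" "A \<subseteq> B" "\<And>b. b \<notin> A \<Longrightarrow> x b = \<zero>"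
  shows "x \<in> carrier (free_module R B)"
proof -
  have "{b. x b \<noteq> \<zero>} \<subseteq> A" using assms(4) by blast
  then have "finite {b. x b \<noteq> \<zero>}" "{b. x b \<noteq> \<zero>} \<subseteq> B"
    using assms(2,3) finite_subset by auto
  then show ?thesis using assms(1) by (auto simp: free_module_def)
qed

lemma free_module_add_closed:
  assumes "x \<in> carrier (free_module R B)" "y \<in> carrier (free_module R B)"
  shows "(\<lambda>b. x b \<oplus> y b) \<in> carrier (free_module R B)"
  using assms free_module_value[OF assms(1)] free_module_value[OF assms(2)]
  by (intro free_module_memI[where A = "{b. x b \<noteq> \<zero>} \<union> {b. y b \<noteq> \<zero>}"])
    (auto dest: free_module_finite free_module_support)

lemma free_module_smult_closed:
  assumes "c \<in> carrier R" "x \<in> carrier (free_module R B)"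
  shows "(\<lambda>b. c \<otimes> x b) \<in> carrier (free_module R B)"
  using assms free_module_value[OF assms(2)]
  by (intro free_module_memI[where A = "{b. x b \<noteq> \<zero>}"])
    (auto dest: free_module_finite free_module_support)

lemma basis_vec_closed: "b \<in> B \<Longrightarrow> basis_vec R b \<in> carrier (free_module R B)"
  by (intro free_module_memI[where A = "{b}"]) (auto simp: basis_vec_def)

lemma free_module_induct [consumes 1, case_names zero add]:
  assumes "x \<in> carrier (free_module R B)"
    and zero: "P (\<lambda>b. \<zero>)"
    and add: "\<And>x a b. \<lbrakk>x \<in> carrier (free_module R B); a \<in> carrier R; b \<in> B; P x\<rbrakk>
      \<Longrightarrow> P (\<lambda>c. x c \<oplus> a \<otimes> basis_vec R b c)"
  shows "P x"
proof -
  have "P x" if "finite A" "A \<subseteq> B" "\<And>b. x b \<in> carrier R" "\<And>b. b \<notin> A \<Longrightarrow> x b = \<zero>" for A x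
    using that
  proof (induction A arbitrary: x rule: finite_induct)
    case empty
    then have "x = (\<lambda>b. \<zero>)" by auto
    then show ?case using zero by simp
  next
    case (insert b A)
    let ?y = "x(b := \<zero>)"
    have "P ?y" using insert.prems by (intro insert.IH) auto
    moreover have "?y \<in> carrier (free_module R B)"
      using insert by (intro free_module_memI[where A = A]) auto
    ultimately have "P (\<lambda>c. ?y c \<oplus> x b \<otimes> basis_vec R b c)"
      using insert.prems add[of ?y "x b" b] by blast
    moreover have "(\<lambda>c. ?y c \<oplus> x b \<otimes> basis_vec R b c) = x"
      using insert.prems(2) by (auto simp: basis_vec_def)
    ultimately show ?case by simp
  qed
  from this[OF free_module_finite free_module_support, OF assms(1) assms(1)]
  show ?thesis using free_module_value[OF assms(1)] by blast
qed

lemma linear_form_closed: "linear_form R M f \<Longrightarrow> x \<in> carrier M \<Longrightarrow> f x \<in> carrier R"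
  by (auto simp: linear_form_def)

lemma linear_form_zero:
  assumes "linear_form R (free_module R B) f"
  shows "f (\<lambda>b. \<zero>) = \<zero>"
proof -
  have z: "(\<lambda>b. \<zero>) \<in> carrier (free_module R B)" by (auto simp: free_module_def)
  have "f (\<zero> \<odot>\<^bsub>free_module R B\<^esub> (\<lambda>b. \<zero>)) = \<zero> \<otimes> f (\<lambda>b. \<zero>)"
    using assms z unfolding linear_form_def by blast
  then show ?thesis using linear_form_closed[OF assms z] by simp
qed

lemma linear_form_eqI:
  assumes f: "linear_form R (free_module R B) f" and g: "linear_form R (free_module R B) g"
    and eq: "\<And>b. b \<in> B \<Longrightarrow> f (basis_vec R b) = g (basis_vec R b)"
    and x: "x \<in> carrier (free_module R B)"
  shows "f x = g x"
  using x
proof (induction rule: free_module_induct)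
  case zero
  show ?case using linear_form_zero[OF f] linear_form_zero[OF g] by simp
next
  case (add x a b)
  have *: "h (\<lambda>c. x c \<oplus> a \<otimes> basis_vec R b c) = h x \<oplus> a \<otimes> h (basis_vec R b)"
    if "linear_form R (free_module R B) h" for h
    using that add basis_vec_closed[of b B] free_module_smult_closed[of a "basis_vec R b" B]
    unfolding linear_form_def free_module_add free_module_smult by simp
  show ?case using *[OF f] *[OF g] eq add by simp
qed

text \<open>Summing over a superset of the support makes linearity visible, and it avoids a case
  distinction on whether \<open>\<one> = \<zero>\<close>.\<close>

lemma lin_ext_superset:
  assumes "x \<in> carrier (free_module R B)" "\<phi> \<in> B \<rightarrow> carrier R"
    and "finite A" "{b. x b \<noteq> \<zero>} \<subseteq> A" "A \<subseteq> B"
  shows "lin_ext R \<phi> x = (\<Oplus>b\<in>A. x b \<otimes> \<phi> b)"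
  unfolding lin_ext_def
proof (rule add.finprod_mono_neutral_cong_left)
  show "x b \<otimes> \<phi> b = \<zero>" if "b \<in> A - {b. x b \<noteq> \<zero>}" for b
    using that assms by (auto intro!: l_null)
  show "(\<lambda>b. x b \<otimes> \<phi> b) \<in> A \<rightarrow> carrier R"
    using assms free_module_value[OF assms(1)] by (auto simp: Pi_def)
qed (use assms in auto)

lemma linear_form_lin_ext:
  assumes "\<phi> \<in> B \<rightarrow> carrier R"
  shows "linear_form R (free_module R B) (lin_ext R \<phi>)"
  unfolding linear_form_def free_module_add free_module_smult
proof (intro conjI ballI funcsetI)
  fix x assume x: "x \<in> carrier (free_module R B)"
  note fx = free_module_finite[OF x] free_module_support[OF x] free_module_value[OF x]
  let ?A = "{b. x b \<noteq> \<zero>}"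
  have cl: "x b \<otimes> \<phi> b \<in> carrier R" if "b \<in> ?A" for b
    using that assms fx by auto
  show "lin_ext R \<phi> x \<in> carrier R"
    unfolding lin_ext_def using cl by (intro finsum_closed) auto
  fix c assume c: "c \<in> carrier R"
  have "lin_ext R \<phi> (\<lambda>b. c \<otimes> x b) = (\<Oplus>b\<in>?A. (c \<otimes> x b) \<otimes> \<phi> b)"
    using fx c assms by (intro lin_ext_superset[OF free_module_smult_closed[OF c x]]) auto
  also have "\<dots> = (\<Oplus>b\<in>?A. c \<otimes> (x b \<otimes> \<phi> b))"
    using fx c assms by (intro finsum_cong') (auto simp: m_assoc Pi_def)
  also have "\<dots> = c \<otimes> (\<Oplus>b\<in>?A. x b \<otimes> \<phi> b)"
    using fx(1) c cl by (intro finsum_rdistr[symmetric]) auto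
  finally show "lin_ext R \<phi> (\<lambda>b. c \<otimes> x b) = c \<otimes> lin_ext R \<phi> x"
    by (simp add: lin_ext_def)
next
  fix x y assume x: "x \<in> carrier (free_module R B)" and y: "y \<in> carrier (free_module R B)"
  note fx = free_module_finite[OF x] free_module_support[OF x] free_module_value[OF x]
  note fy = free_module_finite[OF y] free_module_support[OF y] free_module_value[OF y]
  let ?A = "{b. x b \<noteq> \<zero>} \<union> {b. y b \<noteq> \<zero>}"
  have A: "finite ?A" "?A \<subseteq> B" using fx fy by auto
  have phi: "\<phi> b \<in> carrier R" if "b \<in> ?A" for b using that A assms by auto
  have "lin_ext R \<phi> (\<lambda>b. x b \<oplus> y b) = (\<Oplus>b\<in>?A. (x b \<oplus> y b) \<otimes> \<phi> b)"
    using A assms by (intro lin_ext_superset[OF free_module_add_closed[OF x y]]) auto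
  also have "\<dots> = (\<Oplus>b\<in>?A. x b \<otimes> \<phi> b \<oplus> y b \<otimes> \<phi> b)"
    using fx(3) fy(3) phi by (intro finsum_cong') (auto simp: l_distr Pi_def)
  also have "\<dots> = (\<Oplus>b\<in>?A. x b \<otimes> \<phi> b) \<oplus> (\<Oplus>b\<in>?A. y b \<otimes> \<phi> b)"
    using A fx(3) fy(3) phi by (intro finsum_addf) (auto simp: Pi_def)
  also have "(\<Oplus>b\<in>?A. x b \<otimes> \<phi> b) = lin_ext R \<phi> x"
    using A by (intro lin_ext_superset[OF x assms, symmetric]) auto
  also have "(\<Oplus>b\<in>?A. y b \<otimes> \<phi> b) = lin_ext R \<phi> y"
    using A by (intro lin_ext_superset[OF y assms, symmetric]) auto
  finally show "lin_ext R \<phi> (\<lambda>b. x b \<oplus> y b) = lin_ext R \<phi> x \<oplus> lin_ext R \<phi> y" .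
qed

lemma lin_ext_basis_vec:
  assumes "\<phi> b \<in> carrier R"
  shows "lin_ext R \<phi> (basis_vec R b) = \<phi> b"
proof -
  have "lin_ext R \<phi> (basis_vec R b) = (\<Oplus>c\<in>{b}. basis_vec R b c \<otimes> \<phi> c)"
    using assms by (intro lin_ext_superset[where B = "{b}"] basis_vec_closed)
      (auto simp: basis_vec_def)
  then show ?thesis using assms by (simp add: basis_vec_def)
qed

lemma lin_ext_cong:
  assumes "x \<in> carrier (free_module R B)" "\<And>b. b \<in> B \<Longrightarrow> \<phi> b = \<psi> b" "\<psi> \<in> B \<rightarrow> carrier R"
  shows "lin_ext R \<phi> x = lin_ext R \<psi> x"
proof (rule linear_form_eqI[OF linear_form_lin_ext linear_form_lin_ext _ assms(1)])
  show "\<phi> \<in> B \<rightarrow> carrier R" using assms by auto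
  show "lin_ext R \<phi> (basis_vec R b) = lin_ext R \<psi> (basis_vec R b)" if "b \<in> B" for b
    using that assms(2)[OF that] assms(3) by (auto simp: lin_ext_basis_vec Pi_iff)
qed (rule assms)

lemma lin_ext_singleton:
  assumes "x \<in> carrier (free_module R {u})" "\<phi> u \<in> carrier R"
  shows "lin_ext R \<phi> x = x u \<otimes> \<phi> u"
proof -
  have "lin_ext R \<phi> x = (\<Oplus>b\<in>{u}. x b \<otimes> \<phi> b)"
    using assms free_module_support[OF assms(1)]
    by (intro lin_ext_superset[OF assms(1)]) auto
  then show ?thesis using assms free_module_value[OF assms(1)] by simp
qed

text \<open>The coefficient of \<open>lin_push h x\<close> at a fixed \<open>c\<close> is itself the linear extension of an
  indicator function, so that everything about \<open>lin_push\<close> reduces to \<open>lin_ext\<close>.\<close>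

lemma lin_push_eq_lin_ext:
  assumes "x \<in> carrier (free_module R B)"
  shows "lin_push R h x c = lin_ext R (\<lambda>b. basis_vec R (h b) c) x"
  unfolding lin_push_def lin_ext_def
proof (rule add.finprod_mono_neutral_cong_left)
  show "(\<lambda>b. x b \<otimes> basis_vec R (h b) c) \<in> {b. x b \<noteq> \<zero>} \<rightarrow> carrier R"
    using free_module_value[OF assms] by (auto simp: basis_vec_def)
qed (use free_module_finite[OF assms] free_module_value[OF assms] in
    \<open>auto simp: basis_vec_def\<close>)

lemma lin_push_basis_vec: "lin_push R h (basis_vec R b) = basis_vec R (h b)"
proof
  fix c
  have "lin_push R h (basis_vec R b) c = lin_ext R (\<lambda>b. basis_vec R (h b) c) (basis_vec R b)"
    by (rule lin_push_eq_lin_ext[where B = "{b}"]) (auto intro: basis_vec_closed)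
  also have "\<dots> = basis_vec R (h b) c"
    by (rule lin_ext_basis_vec) (auto simp: basis_vec_def)
  finally show "lin_push R h (basis_vec R b) c = basis_vec R (h b) c" .
qed

lemma lin_push_linear:
  "linear_form R (free_module R B) (\<lambda>x. lin_push R h x c)"
proof -
  have "linear_form R (free_module R B) (lin_ext R (\<lambda>b. basis_vec R (h b) c))"
    by (rule linear_form_lin_ext) (auto simp: basis_vec_def)
  then show ?thesis
    using lin_push_eq_lin_ext[of _ B h c]
    by (simp add: linear_form_def free_module_add_closed free_module_smult_closed Pi_iff)
qed

lemma lin_push_closed:
  assumes "x \<in> carrier (free_module R B)" "h \<in> B \<rightarrow> C"
  shows "lin_push R h x \<in> carrier (free_module R C)"
proof (rule free_module_memI)
  show "lin_push R h x c \<in> carrier R" for c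
    using lin_push_linear[of B h c] assms(1) by (rule linear_form_closed)
  show "finite (h ` {b. x b \<noteq> \<zero>})" using free_module_finite[OF assms(1)] by simp
  show "h ` {b. x b \<noteq> \<zero>} \<subseteq> C" using free_module_support[OF assms(1)] assms(2) by auto
  show "lin_push R h x c = \<zero>" if "c \<notin> h ` {b. x b \<noteq> \<zero>}" for c
  proof -
    have "{b. x b \<noteq> \<zero> \<and> h b = c} = {}" using that by auto
    then show ?thesis by (simp only: lin_push_def finsum_empty)
  qed
qed

lemma linear_form_comp_lin_push:
  assumes "linear_form R (free_module R C) f" "h \<in> B \<rightarrow> C"
  shows "linear_form R (free_module R B) (\<lambda>x. f (lin_push R h x))"
proof -
  have "lin_push R h (\<lambda>b. x b \<oplus> y b) = (\<lambda>c. lin_push R h x c \<oplus> lin_push R h y c)"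
    if "x \<in> carrier (free_module R B)" "y \<in> carrier (free_module R B)" for x y
    using lin_push_linear[of B h] that by (auto simp: linear_form_def)
  moreover have "lin_push R h (\<lambda>b. a \<otimes> x b) = (\<lambda>c. a \<otimes> lin_push R h x c)"
    if "x \<in> carrier (free_module R B)" "a \<in> carrier R" for x a
    using lin_push_linear[of B h] that by (auto simp: linear_form_def)
  ultimately show ?thesis
    using assms lin_push_closed[OF _ assms(2)] by (simp add: linear_form_def Pi_iff)
qed

lemma lin_ext_lin_push:
  assumes x: "x \<in> carrier (free_module R B)" and h: "h \<in> B \<rightarrow> C" and \<phi>: "\<phi> \<in> C \<rightarrow> carrier R"
  shows "lin_ext R \<phi> (lin_push R h x) = lin_ext R (\<lambda>b. \<phi> (h b)) x"
proof (rule linear_form_eqI[OF _ _ _ x])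
  show "linear_form R (free_module R B) (\<lambda>x. lin_ext R \<phi> (lin_push R h x))"
    using linear_form_lin_ext[OF \<phi>] h by (rule linear_form_comp_lin_push)
  show "linear_form R (free_module R B) (lin_ext R (\<lambda>b. \<phi> (h b)))"
    using h \<phi> by (intro linear_form_lin_ext) auto
  show "lin_ext R \<phi> (lin_push R h (basis_vec R b)) = lin_ext R (\<lambda>b. \<phi> (h b)) (basis_vec R b)"
    if "b \<in> B" for b
    using that h \<phi> by (simp add: lin_push_basis_vec lin_ext_basis_vec Pi_iff)
qed

lemma linear_form_smult:
  assumes "linear_form R (free_module R B) f" "c \<in> carrier R"
  shows "linear_form R (free_module R B) (\<lambda>x. c \<otimes> f x)"
  using assms unfolding linear_form_def by (auto simp: Pi_iff r_distr m_lcomm)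

section \<open>Free modules of rank one\<close>

lemma free_rank_one_onI:
  fixes M :: "('a, 'm) module"
  assumes carr: "carrier M = (\<lambda>c. c \<odot>\<^bsub>M\<^esub> g) ` carrier R"
    and inj: "inj_on (\<lambda>c. c \<odot>\<^bsub>M\<^esub> g) (carrier R)"
    and one: "\<one> \<odot>\<^bsub>M\<^esub> g = g"
    and zero: "\<zero>\<^bsub>M\<^esub> = \<zero> \<odot>\<^bsub>M\<^esub> g"
    and add: "\<And>c d. \<lbrakk>c \<in> carrier R; d \<in> carrier R\<rbrakk>
      \<Longrightarrow> c \<odot>\<^bsub>M\<^esub> g \<oplus>\<^bsub>M\<^esub> d \<odot>\<^bsub>M\<^esub> g = (c \<oplus> d) \<odot>\<^bsub>M\<^esub> g"
    and smult: "\<And>c d. \<lbrakk>c \<in> carrier R; d \<in> carrier R\<rbrakk> \<Longrightarrow> c \<odot>\<^bsub>M\<^esub> (d \<odot>\<^bsub>M\<^esub> g) = (c \<otimes> d) \<odot>\<^bsub>M\<^esub> g"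
  shows "free_rank_one_on R M g"
  unfolding free_rank_one_on_def
proof (intro conjI ballI)
  have neg: "\<exists>y\<in>carrier M. y \<oplus>\<^bsub>M\<^esub> x = \<zero>\<^bsub>M\<^esub>" if "x \<in> carrier M" for x
  proof -
    from that obtain c where c: "c \<in> carrier R" "x = c \<odot>\<^bsub>M\<^esub> g" by (auto simp: carr)
    then show ?thesis
      by (intro bexI[of _ "(\<ominus> c) \<odot>\<^bsub>M\<^esub> g"]) (auto simp: carr add zero l_neg)
  qed
  have "abelian_group M"
  proof (rule abelian_groupI)
    show "x \<oplus>\<^bsub>M\<^esub> y = y \<oplus>\<^bsub>M\<^esub> x" if "x \<in> carrier M" "y \<in> carrier M" for x y
      using that by (auto simp: carr add a_comm)
  qed (use neg in \<open>auto simp: carr add zero a_assoc\<close>)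
  then show "module R M"
    by (intro moduleI is_cring) (auto simp: carr add smult l_distr r_distr m_assoc)
  show "g \<in> carrier M" using one by (force simp: carr)
  show "\<exists>!c. c \<in> carrier R \<and> x = c \<odot>\<^bsub>M\<^esub> g" if "x \<in> carrier M" for x
    using that inj by (auto simp: carr inj_on_def)
qed

text \<open>If there are no nonzero coboundaries, cohomology classes are singletons.\<close>

lemma free_rank_one_on_quotient_zero:
  fixes M :: "('a, 'm) module"
  assumes "free_rank_one_on R M g"
  shows "free_rank_one_on R (quotient_module M {\<zero>\<^bsub>M\<^esub>}) {g}"
proof -
  interpret M: module R M using assms by (simp add: free_rank_one_on_def)
  have g: "g \<in> carrier M" using assms by (simp add: free_rank_one_on_def)
  have ex1: "\<exists>!c. c \<in> carrier R \<and> x = c \<odot>\<^bsub>M\<^esub> g" if "x \<in> carrier M" for x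
    using assms that by (simp add: free_rank_one_on_def)
  let ?Q = "quotient_module M {\<zero>\<^bsub>M\<^esub>}"
  have carr: "carrier ?Q = (\<lambda>x. {x}) ` carrier M"
    by (auto simp: quotient_module_def A_RCOSETS_def' a_r_coset_def')
  have smult: "c \<odot>\<^bsub>?Q\<^esub> {x} = {c \<odot>\<^bsub>M\<^esub> x}" if "c \<in> carrier R" "x \<in> carrier M" for c x
    using that by (simp add: quotient_module_def a_r_coset_def')
  have add: "{x} \<oplus>\<^bsub>?Q\<^esub> {y} = {x \<oplus>\<^bsub>M\<^esub> y}" for x y
    by (simp add: quotient_module_def set_add_def')
  show ?thesis
  proof (rule free_rank_one_onI)
    show "carrier ?Q = (\<lambda>c. c \<odot>\<^bsub>?Q\<^esub> {g}) ` carrier R"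
    proof (intro subset_antisym subsetI)
      fix A assume "A \<in> carrier ?Q"
      then obtain x where x: "x \<in> carrier M" "A = {x}" by (auto simp: carr)
      with ex1 obtain c where "c \<in> carrier R" "x = c \<odot>\<^bsub>M\<^esub> g" by blast
      with x g show "A \<in> (\<lambda>c. c \<odot>\<^bsub>?Q\<^esub> {g}) ` carrier R" by (force simp: smult)
    qed (use g in \<open>auto simp: carr smult\<close>)
    show "inj_on (\<lambda>c. c \<odot>\<^bsub>?Q\<^esub> {g}) (carrier R)"
    proof (rule inj_onI)
      fix c d assume *: "c \<in> carrier R" "d \<in> carrier R" "c \<odot>\<^bsub>?Q\<^esub> {g} = d \<odot>\<^bsub>?Q\<^esub> {g}"
      then have "c \<odot>\<^bsub>M\<^esub> g = d \<odot>\<^bsub>M\<^esub> g" using g by (simp add: smult)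
      then show "c = d" using ex1[of "c \<odot>\<^bsub>M\<^esub> g"] * g by auto
    qed
    show "\<zero>\<^bsub>?Q\<^esub> = \<zero> \<odot>\<^bsub>?Q\<^esub> {g}"
      using g by (simp add: smult) (simp add: quotient_module_def)
  qed (use g in \<open>auto simp: smult add M.smult_l_distr M.smult_assoc1\<close>)
qed

section \<open>Cohomology in degrees zero and one\<close>

lemma linearize_simps [simp]:
  "bc_mod (linearize R Y) I = free_module R (ss_elems Y I)"
  "bc_map (linearize R Y) I s = lin_push R (ss_map Y I s)"
  "bc_res (linearize R Y) I S = lin_push R (ss_res Y I S)"
  by (simp_all add: linearize_def)

lemma cochain_linear:
  assumes "\<alpha> \<in> carrier (cochains R L n)" "F \<in> decompositions n"
  shows "linear_form R (bc_mod L (\<Union>(set F))) (\<alpha> F)"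
  using assms by (simp add: cochains_def)

lemma cochain_outside:
  assumes "\<alpha> \<in> carrier (cochains R L n)"
    and "\<not> (F \<in> decompositions n \<and> x \<in> carrier (bc_mod L (\<Union>(set F))))"
  shows "\<alpha> F x = \<zero>"
  using assms unfolding cochains_def by simp

lemma cochain_closed:
  assumes "\<alpha> \<in> carrier (cochains R L n)"
  shows "\<alpha> F x \<in> carrier R"
  using cochain_linear[OF assms] cochain_outside[OF assms] linear_form_closed
  by (metis zero_closed)

text \<open>For partitions, \<open>n = 0\<close> with a constant weight gives all \<open>0\<close>-cochains, and \<open>n = 1\<close> with the
  weight \<open>k \<mapsto> k\<close> the cardinality cochain, so that naturality needs to be checked only once.\<close>

definition size_cochain ::
    "'c set_species \<Rightarrow> nat \<Rightarrow> (nat \<Rightarrow> 'a) \<Rightarrow> nat set list \<Rightarrow> ('c \<Rightarrow> 'a) \<Rightarrow> 'a" where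
  "size_cochain Y n w F x =
     (if F \<in> decompositions n \<and> x \<in> carrier (free_module R (ss_elems Y (\<Union>(set F))))
      then lin_ext R (\<lambda>z. w (card (\<Union>(set F)))) x else \<zero>)"

lemma cardinality_cochain_eq:
  "cardinality_cochain R = size_cochain partition_species 1 (\<lambda>k. [k] \<cdot> \<one>)"
  by (intro ext) (simp add: cardinality_cochain_def size_cochain_def)

text \<open>Naturality holds because the coefficients depend only on the number of points, and because
  relabelling a formal sum of structures does not change the sum of its coefficients.\<close>

lemma size_cochain_closed:
  assumes "cosymmetric_set_species Y" and w: "\<And>k. w k \<in> carrier R"
  shows "size_cochain Y n w \<in> carrier (cochains R (linearize R Y) n)"
proof -
  interpret cosymmetric_set_species Y by fact
  have lin: "linear_form R (free_module R (ss_elems Y (\<Union>(set F)))) (size_cochain Y n w F)"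
    if F: "F \<in> decompositions n" for F
  proof -
    have "linear_form R (free_module R (ss_elems Y (\<Union>(set F)))) (lin_ext R (\<lambda>z. w (card (\<Union>(set F)))))"
      using w by (intro linear_form_lin_ext) auto
    then show ?thesis
      using F
      by (simp add: linear_form_def size_cochain_def Pi_iff free_module_add_closed
          free_module_smult_closed)
  qed
  have nat: "size_cochain Y n w (map ((`) \<sigma>) F) (lin_push R (ss_map Y (\<Union>(set F)) \<sigma>) x)
      = size_cochain Y n w F x"
    if F: "F \<in> decompositions n" and inj: "inj_on \<sigma> (\<Union>(set F))"
      and x: "x \<in> carrier (free_module R (ss_elems Y (\<Union>(set F))))" for F \<sigma> x
  proof -
    let ?I = "\<Union>(set F)"
    have fin: "finite ?I" using F by (simp add: decompositions_def)
    have un: "\<Union>(set (map ((`) \<sigma>) F)) = \<sigma> ` ?I" by auto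
    have "\<sigma> ` (F ! i) \<inter> \<sigma> ` (F ! j) = {}" if "i < n" "j < n" "i \<noteq> j" for i j
    proof -
      have "F ! i \<subseteq> ?I" "F ! j \<subseteq> ?I" "F ! i \<inter> F ! j = {}"
        using that F by (auto simp: decompositions_def disjoint_family_on_def intro: nth_mem)
      then show ?thesis using inj_on_image_Int[OF inj, of "F ! i" "F ! j"] by simp
    qed
    moreover have "finite (\<Union>(set (map ((`) \<sigma>) F)))"
      using fin by (simp only: un finite_imageI)
    ultimately have mem: "map ((`) \<sigma>) F \<in> decompositions n"
      using F by (auto simp: decompositions_def disjoint_family_on_def)
    have h: "ss_map Y ?I \<sigma> \<in> ss_elems Y ?I \<rightarrow> ss_elems Y (\<sigma> ` ?I)"
      using map_closed[OF fin inj] by auto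
    have "card (\<sigma> ` ?I) = card ?I" using inj by (rule card_image)
    then show ?thesis
      unfolding size_cochain_def un
      using F mem x lin_push_closed[OF x h] w
      by (simp add: lin_ext_lin_push[OF x h])
  qed
  show ?thesis
    using lin nat by (simp add: cochains_def) (simp add: size_cochain_def)
qed

lemma coface_closed:
  "\<alpha> \<in> carrier (cochains R L n) \<Longrightarrow> coface R L n i \<alpha> F x \<in> carrier R"
  by (simp add: coface_def Let_def cochain_closed)

lemma size_cochain_basis_vec:
  assumes "F \<in> decompositions n" "z \<in> ss_elems Y (\<Union>(set F))" "w (card (\<Union>(set F))) \<in> carrier R"
  shows "size_cochain Y n w F (basis_vec R z) = w (card (\<Union>(set F)))"
  using assms by (simp add: size_cochain_def basis_vec_closed lin_ext_basis_vec)

text \<open>Both cofaces restrict to the empty set, so they cancel.\<close>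

lemma coboundary_0:
  assumes "\<alpha> \<in> carrier (cochains R L 0)"
  shows "coboundary R L 0 \<alpha> = (\<lambda>F x. \<zero>)"
proof (intro ext)
  fix F x
  have eq: "coface R L 0 (Suc 0) \<alpha> F x = coface R L 0 0 \<alpha> F x"
    by (auto simp: coface_def Let_def decompositions_1)
  show "coboundary R L 0 \<alpha> F x = \<zero>"
    using coface_closed[OF assms]
    by (simp add: coboundary_def atLeast0AtMost eq l_minus r_neg l_neg)
qed

lemma coboundary_1:
  assumes \<alpha>: "\<alpha> \<in> carrier (cochains R (linearize R Y) 1)"
    and ST: "finite S" "finite T" "S \<inter> T = {}"
    and x: "x \<in> carrier (free_module R (ss_elems Y (S \<union> T)))"
  shows "coboundary R (linearize R Y) 1 \<alpha> [S, T] x =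
     \<alpha> [S] (lin_push R (ss_res Y (S \<union> T) S) x) \<oplus> \<alpha> [T] (lin_push R (ss_res Y (S \<union> T) T) x)
       \<ominus> \<alpha> [S \<union> T] x"
proof -
  let ?L = "linearize R Y"
  have F: "[S, T] \<in> decompositions (Suc (Suc 0))" using ST by (auto simp: decompositions_2)
  have diff: "S \<union> T - S = T" "S \<union> T - T = S" using ST by auto
  have c0: "coface R ?L (Suc 0) 0 \<alpha> [S, T] x = \<alpha> [T] (lin_push R (ss_res Y (S \<union> T) T) x)"
    using F x by (simp add: coface_def Let_def diff)
  have c1: "coface R ?L (Suc 0) (Suc 0) \<alpha> [S, T] x = \<alpha> [S \<union> T] x"
    using F x by (simp add: coface_def Let_def)
  have c2: "coface R ?L (Suc 0) (Suc (Suc 0)) \<alpha> [S, T] x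
      = \<alpha> [S] (lin_push R (ss_res Y (S \<union> T) S) x)"
    using F x by (simp add: coface_def Let_def diff)
  show ?thesis
    using cochain_closed[OF \<alpha>] coface_closed[OF \<alpha>, of _ "[S, T]" x]
    by (simp add: coboundary_def atLeast0AtMost c0 c1 c2 l_minus r_minus minus_eq a_ac)
qed

text \<open>Additivity under decompositions is the form in which the cocycle condition is used.\<close>

lemma cocycle_1_iff_additive:
  assumes \<alpha>: "\<alpha> \<in> carrier (cochains R (linearize R Y) 1)"
  shows "\<alpha> \<in> cocycles R (linearize R Y) 1 \<longleftrightarrow>
    (\<forall>S T x. finite S \<longrightarrow> finite T \<longrightarrow> S \<inter> T = {} \<longrightarrow> x \<in> carrier (free_module R (ss_elems Y (S \<union> T))) \<longrightarrow>
      \<alpha> [S \<union> T] x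
        = \<alpha> [S] (lin_push R (ss_res Y (S \<union> T) S) x) \<oplus> \<alpha> [T] (lin_push R (ss_res Y (S \<union> T) T) x))"
    (is "_ \<longleftrightarrow> ?additive")
proof -
  note cl = cochain_closed[OF \<alpha>]
  have outside: "coboundary R (linearize R Y) 1 \<alpha> F x = \<zero>"
    if "\<not> (F \<in> decompositions 2 \<and> x \<in> carrier (free_module R (ss_elems Y (\<Union>(set F)))))" for F x
  proof -
    have "coface R (linearize R Y) 1 i \<alpha> F x = \<zero>" for i
      using that by (auto simp: coface_def Let_def numeral_2_eq_2)
    then show ?thesis by (simp add: coboundary_def)
  qed
  have "\<alpha> \<in> cocycles R (linearize R Y) 1 \<longleftrightarrow> (\<forall>F x. coboundary R (linearize R Y) 1 \<alpha> F x = \<zero>)"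
    using \<alpha> by (simp add: cocycles_def) (simp add: cochains_def fun_eq_iff)
  also have "\<dots> \<longleftrightarrow> (\<forall>S T x. finite S \<longrightarrow> finite T \<longrightarrow> S \<inter> T = {} \<longrightarrow>
      x \<in> carrier (free_module R (ss_elems Y (S \<union> T))) \<longrightarrow> coboundary R (linearize R Y) 1 \<alpha> [S, T] x = \<zero>)"
    (is "_ \<longleftrightarrow> ?inside")
  proof
    assume inside: ?inside
    show "\<forall>F x. coboundary R (linearize R Y) 1 \<alpha> F x = \<zero>"
    proof (intro allI)
      fix F x
      show "coboundary R (linearize R Y) 1 \<alpha> F x = \<zero>"
      proof (cases "F \<in> decompositions 2 \<and> x \<in> carrier (free_module R (ss_elems Y (\<Union>(set F))))")
        case True
        then obtain S T where "finite S" "finite T" "S \<inter> T = {}" "F = [S, T]"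
          by (auto simp: numeral_2_eq_2 decompositions_2)
        with True inside show ?thesis by simp
      qed (rule outside)
    qed
  qed simp
  also have "\<dots> \<longleftrightarrow> ?additive"
  proof -
    have "(a \<oplus> b \<ominus> c = \<zero>) = (c = a \<oplus> b)"
      if "a \<in> carrier R" "b \<in> carrier R" "c \<in> carrier R" for a b c
      using that r_right_minus_eq[of "a \<oplus> b" c] by auto
    then show ?thesis using coboundary_1[OF \<alpha>] cl by simp
  qed
  finally show ?thesis .
qed

lemma cardinality_cocycle:
  "cardinality_cochain R \<in> cocycles R (linearize R partition_species) 1"
proof -
  let ?\<kappa> = "size_cochain partition_species 1 (\<lambda>k. [k] \<cdot> \<one>)"
  interpret cosymmetric_set_species partition_species by (rule cosymmetric_partition_species)
  have cochain: "?\<kappa> \<in> carrier (cochains R (linearize R partition_species) 1)"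
    by (intro size_cochain_closed cosymmetric_partition_species) simp
  have "?\<kappa> [S \<union> T] x = ?\<kappa> [S] (lin_push R (ss_res partition_species (S \<union> T) S) x)
      \<oplus> ?\<kappa> [T] (lin_push R (ss_res partition_species (S \<union> T) T) x)"
    if ST: "finite S" "finite T" "S \<inter> T = {}"
      and x: "x \<in> carrier (free_module R (ss_elems partition_species (S \<union> T)))" for S T x
  proof -
    have h: "ss_res partition_species (S \<union> T) U
        \<in> ss_elems partition_species (S \<union> T) \<rightarrow> ss_elems partition_species U"
      if "U \<subseteq> S \<union> T" for U
      using that ST res_closed[of "S \<union> T" U] by auto
    have val: "?\<kappa> [U] (lin_push R (ss_res partition_species (S \<union> T) U) x)
        = lin_ext R (\<lambda>z. [card U] \<cdot> \<one>) x" if "U \<subseteq> S \<union> T" for U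
    proof -
      have "finite U" using that ST finite_subset by blast
      then show ?thesis
        using lin_push_closed[OF x h[OF that]] lin_ext_lin_push[OF x h[OF that]]
        by (simp add: size_cochain_def decompositions_1)
    qed
    note fx = free_module_finite[OF x] free_module_value[OF x]
    have "lin_ext R (\<lambda>z. [card (S \<union> T)] \<cdot> \<one>) x
        = lin_ext R (\<lambda>z. [card S] \<cdot> \<one>) x \<oplus> lin_ext R (\<lambda>z. [card T] \<cdot> \<one>) x"
      using ST fx
      by (simp add: lin_ext_def card_Un_disjoint add.nat_pow_mult[symmetric] r_distr
          finsum_addf Pi_iff)
    moreover have "?\<kappa> [S \<union> T] x = lin_ext R (\<lambda>z. [card (S \<union> T)] \<cdot> \<one>) x"
      using ST x by (simp add: size_cochain_def decompositions_1)
    ultimately show ?thesis using val[of S] val[of T] by simp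
  qed
  then show ?thesis
    unfolding cardinality_cochain_eq cocycle_1_iff_additive[OF cochain] by blast
qed

text \<open>A cocycle is additive under decomposition and hence determined, by peeling off one point
  after the other, by its common value on the one-point partitions.\<close>

lemma partition_cocycle_eq:
  assumes \<alpha>: "\<alpha> \<in> cocycles R (linearize R partition_species) 1"
  shows "\<alpha> = (\<lambda>F x. \<alpha> [{0}] (basis_vec R {{0}}) \<otimes> cardinality_cochain R F x)"
proof -
  let ?P = "partition_species" and ?L = "linearize R partition_species"
  define c where "c = \<alpha> [{0}] (basis_vec R {{0}})"
  have cochain: "\<alpha> \<in> carrier (cochains R ?L 1)" using \<alpha> by (simp add: cocycles_def)
  note cl = cochain_closed[OF cochain]
  have c: "c \<in> carrier R" by (simp add: c_def cl)
  have elems: "z \<in> ss_elems ?P I \<longleftrightarrow> partition_on I z" for I z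
    by (simp add: partition_species_def)
  have additive: "\<alpha> [S \<union> T] (basis_vec R z)
      = \<alpha> [S] (basis_vec R (ss_res ?P (S \<union> T) S z)) \<oplus> \<alpha> [T] (basis_vec R (ss_res ?P (S \<union> T) T z))"
    if "finite S" "finite T" "S \<inter> T = {}" "partition_on (S \<union> T) z" for S T z
  proof -
    have "basis_vec R z \<in> carrier (free_module R (ss_elems ?P (S \<union> T)))"
      using that by (simp add: basis_vec_closed elems)
    then show ?thesis
      using \<alpha> that unfolding cocycle_1_iff_additive[OF cochain]
      by (simp add: lin_push_basis_vec)
  qed
  have res: "partition_on S (ss_res ?P I S z)" if "finite I" "S \<subseteq> I" "partition_on I z" for I S z
    using cosymmetric_set_species.res_closed[OF cosymmetric_partition_species that(1,2), of z] that
    by (simp add: elems)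
  have sing: "\<alpha> [{i}] (basis_vec R {{i}}) = c" for i
  proof -
    have "[{0}] \<in> decompositions 1" "basis_vec R {{0}} \<in> carrier (free_module R (ss_elems ?P {0}))"
      by (auto simp: decompositions_1 elems basis_vec_closed partition_on_def)
    then have "\<alpha> (map ((`) (\<lambda>_. i)) [{0}]) (lin_push R (ss_map ?P {0} (\<lambda>_. i)) (basis_vec R {{0}})) = c"
      using cochain unfolding cochains_def c_def by (force simp: inj_on_def)
    then show ?thesis by (simp add: lin_push_basis_vec partition_species_def)
  qed
  have basis: "\<alpha> [I] (basis_vec R z) = c \<otimes> [card I] \<cdot> \<one>" if "finite I" "partition_on I z" for I z
    using that
  proof (induction I arbitrary: z rule: finite_induct)
    case empty
    then have z: "z = {}" by (auto simp: partition_on_def)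
    \<comment> \<open>The decomposition of the empty set into two empty sets makes the value there equal to its own double.\<close>
    have "\<alpha> [{}] (basis_vec R {}) = \<alpha> [{}] (basis_vec R {}) \<oplus> \<alpha> [{}] (basis_vec R {})"
      using additive[of "{}" "{}" "{}"] by (simp add: partition_on_def partition_species_def)
    then have "\<alpha> [{}] (basis_vec R {}) = \<zero>"
      using cl add.r_cancel_one' by metis
    then show ?case using c by (simp add: z)
  next
    case (insert i I)
    let ?r = "ss_res ?P (insert i I)"
    have "ss_res ?P (insert i I) {i} z = {{i}}"
      using res[of "insert i I" "{i}" z] insert
      by (simp add: partition_on_singleton)
    moreover have "partition_on I (?r I z)"
      using res[of "insert i I" I z] insert by auto
    moreover have "\<alpha> [{i} \<union> I] (basis_vec R z)
        = \<alpha> [{i}] (basis_vec R (?r {i} z)) \<oplus> \<alpha> [I] (basis_vec R (?r I z))"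
      using additive[of "{i}" I z] insert by simp
    ultimately have "\<alpha> [insert i I] (basis_vec R z) = c \<oplus> c \<otimes> [card I] \<cdot> \<one>"
      using insert.IH by (simp add: sing)
    then show ?case using insert c by (simp add: r_distr a_comm)
  qed
  have eq: "\<alpha> F x = c \<otimes> cardinality_cochain R F x" for F x
  proof (cases "F \<in> decompositions 1 \<and> x \<in> carrier (free_module R (ss_elems ?P (\<Union>(set F))))")
    case True
    then obtain I where I: "finite I" "F = [I]" by (auto simp: decompositions_1)
    have F: "[I] \<in> decompositions 1" using I by (simp add: decompositions_1)
    have \<kappa>: "cardinality_cochain R \<in> carrier (cochains R ?L 1)"
      using cardinality_cocycle by (simp add: cocycles_def)
    have "\<alpha> [I] x = c \<otimes> cardinality_cochain R [I] x"
    proof (rule linear_form_eqI[where f = "\<alpha> [I]"])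
      show "linear_form R (free_module R (ss_elems ?P I)) (\<alpha> [I])"
        using cochain_linear[OF cochain F] by simp
      show "linear_form R (free_module R (ss_elems ?P I)) (\<lambda>x. c \<otimes> cardinality_cochain R [I] x)"
        using cochain_linear[OF \<kappa> F] c by (simp add: linear_form_smult)
      show "\<alpha> [I] (basis_vec R z) = c \<otimes> cardinality_cochain R [I] (basis_vec R z)"
        if "z \<in> ss_elems ?P I" for z
        using that I F basis[of I z]
        by (simp add: cardinality_cochain_eq size_cochain_basis_vec elems)
    qed (use True I in simp)
    then show ?thesis by (simp add: I)
  next
    case False
    then have "\<alpha> F x = \<zero>" using cochain_outside[OF cochain] by simp
    then show ?thesis using False c by (auto simp: cardinality_cochain_def)
  qed
  show ?thesis unfolding c_def[symmetric] by (intro ext eq)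
qed


text \<open>The value \<open>\<one>\<close> of \<open>g\<close> makes the coefficient of a multiple of \<open>g\<close> unique.\<close>

lemma cohomology_free_rank_one:
  assumes g: "\<And>F x. g F x \<in> carrier R" and one: "g F\<^sub>0 x\<^sub>0 = \<one>"
    and cocycles: "cocycles R L n = (\<lambda>c F x. c \<otimes> g F x) ` carrier R"
    and coboundaries: "coboundaries R L n = {\<lambda>F x. \<zero>}"
  shows "free_rank_one_on R (cohomology R L n) (cohomology_class R L n g)"
proof -
  let ?M = "(cochains R L n)\<lparr>carrier := cocycles R L n\<rparr>"
  have ops: "\<zero>\<^bsub>?M\<^esub> = (\<lambda>F x. \<zero>)" "a \<oplus>\<^bsub>?M\<^esub> b = (\<lambda>F x. a F x \<oplus> b F x)" "c \<odot>\<^bsub>?M\<^esub> a = (\<lambda>F x. c \<otimes> a F x)"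
    for a b c
    by (simp_all add: cochains_def)
  have "free_rank_one_on R ?M g"
  proof (rule free_rank_one_onI, unfold ops)
    show "carrier ?M = (\<lambda>c F x. c \<otimes> g F x) ` carrier R" by (simp add: cocycles)
    show "inj_on (\<lambda>c F x. c \<otimes> g F x) (carrier R)"
    proof (rule inj_onI)
      fix c d assume *: "c \<in> carrier R" "d \<in> carrier R" "(\<lambda>F x. c \<otimes> g F x) = (\<lambda>F x. d \<otimes> g F x)"
      from fun_cong[OF fun_cong[OF *(3), of F\<^sub>0], of x\<^sub>0] show "c = d"
        using *(1,2) one by simp
    qed
  qed (use g in \<open>auto simp: l_distr m_assoc\<close>)
  from free_rank_one_on_quotient_zero[OF this]
  have "free_rank_one_on R (cohomology R L n) {g}"
    by (simp add: ops cohomology_def coboundaries)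
  moreover have "cohomology_class R L n g = {g}"
    using g by (simp add: cohomology_class_def coboundaries a_r_coset_def' cochains_def)
  ultimately show ?thesis by simp
qed

lemma cohomology_0_partitions:
  "\<exists>g. free_rank_one_on R (cohomology R (linearize R partition_species) 0) g"
proof -
  let ?P = "partition_species" and ?L = "linearize R partition_species"
  define \<epsilon> where "\<epsilon> = size_cochain partition_species 0 (\<lambda>k. \<one>)"
  have elems: "ss_elems ?P {} = {{}}"
    by (auto simp: partition_species_def partition_on_def)
  have \<epsilon>: "\<epsilon> \<in> carrier (cochains R ?L 0)"
    unfolding \<epsilon>_def by (intro size_cochain_closed cosymmetric_partition_species) simp
  have all: "cocycles R ?L 0 = carrier (cochains R ?L 0)"
    by (auto simp: cocycles_def coboundary_0) (simp add: cochains_def)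
  have "c \<otimes> \<epsilon> F x = size_cochain ?P 0 (\<lambda>k. c) F x" if "c \<in> carrier R" for c F x
    using that by (auto simp: \<epsilon>_def size_cochain_def decompositions_0 elems lin_ext_singleton
        free_module_value m_comm)
  then have multiple: "(\<lambda>F x. c \<otimes> \<epsilon> F x) = size_cochain ?P 0 (\<lambda>k. c)" if "c \<in> carrier R" for c
    using that by auto
  have eq: "\<alpha> = size_cochain ?P 0 (\<lambda>k. \<alpha> [] (basis_vec R {}))" if \<alpha>: "\<alpha> \<in> carrier (cochains R ?L 0)" for \<alpha>
  proof (intro ext)
    fix F x
    let ?c = "\<alpha> [] (basis_vec R {})"
    have c: "?c \<in> carrier R" using cochain_closed[OF \<alpha>] .
    have d: "[] \<in> decompositions 0" by (simp add: decompositions_0)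
    show "\<alpha> F x = size_cochain ?P 0 (\<lambda>k. ?c) F x"
    proof (cases "F = [] \<and> x \<in> carrier (free_module R {{}})")
      case True
      have "\<alpha> [] x = lin_ext R (\<lambda>z. ?c) x"
      proof (rule linear_form_eqI[where f = "\<alpha> []"])
        show "linear_form R (free_module R (ss_elems ?P {})) (\<alpha> [])"
          using cochain_linear[OF \<alpha> d] by simp
        show "linear_form R (free_module R (ss_elems ?P {})) (lin_ext R (\<lambda>z. ?c))"
          using c by (intro linear_form_lin_ext) simp
        show "\<alpha> [] (basis_vec R z) = lin_ext R (\<lambda>z. ?c) (basis_vec R z)"
          if "z \<in> ss_elems ?P {}" for z
          using that c by (simp add: lin_ext_basis_vec elems)
      qed (use True in \<open>simp add: elems\<close>)
      then show ?thesis using True by (simp add: size_cochain_def decompositions_0 elems)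
    next
      case False
      then have "\<alpha> F x = \<zero>" using cochain_outside[OF \<alpha>] by (auto simp: decompositions_0 elems)
      then show ?thesis using False by (auto simp: size_cochain_def decompositions_0 elems)
    qed
  qed
  have "carrier (cochains R ?L 0) \<subseteq> (\<lambda>c F x. c \<otimes> \<epsilon> F x) ` carrier R"
  proof
    fix \<alpha> assume \<alpha>: "\<alpha> \<in> carrier (cochains R ?L 0)"
    have c: "\<alpha> [] (basis_vec R {}) \<in> carrier R" by (rule cochain_closed[OF \<alpha>])
    show "\<alpha> \<in> (\<lambda>c F x. c \<otimes> \<epsilon> F x) ` carrier R"
      using eq[OF \<alpha>] multiple[OF c] c by (intro image_eqI) (rule trans, assumption, rule sym)
  qed
  moreover have "(\<lambda>c F x. c \<otimes> \<epsilon> F x) ` carrier R \<subseteq> carrier (cochains R ?L 0)"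
    by (auto simp: multiple intro!: size_cochain_closed cosymmetric_partition_species)
  ultimately have "cocycles R ?L 0 = (\<lambda>c F x. c \<otimes> \<epsilon> F x) ` carrier R"
    using all by blast
  moreover have "\<epsilon> [] (basis_vec R {}) = \<one>"
    by (simp add: \<epsilon>_def size_cochain_basis_vec decompositions_0 elems)
  moreover have "coboundaries R ?L 0 = {\<lambda>F x. \<zero>}" by (simp add: coboundaries_def cochains_def)
  ultimately show ?thesis
    by (intro exI[of _ "cohomology_class R ?L 0 \<epsilon>"] cohomology_free_rank_one cochain_closed[OF \<epsilon>])
qed

lemma cohomology_1_partitions:
  "free_rank_one_on R (cohomology R (linearize R partition_species) 1)
     (cohomology_class R (linearize R partition_species) 1 (cardinality_cochain R))"
proof -
  let ?P = "partition_species" and ?L = "linearize R partition_species"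
  let ?\<kappa> = "cardinality_cochain R"
  have \<kappa>: "?\<kappa> \<in> carrier (cochains R ?L 1)" using cardinality_cocycle by (simp add: cocycles_def)
  have multiple: "(\<lambda>F x. c \<otimes> ?\<kappa> F x) \<in> cocycles R ?L 1" if c: "c \<in> carrier R" for c
  proof -
    have smult: "(\<lambda>F x. c \<otimes> ?\<kappa> F x) \<in> carrier (cochains R ?L 1)"
      using \<kappa> c by (simp add: cochains_def linear_form_smult)
    then show ?thesis
      using cardinality_cocycle c cochain_closed[OF \<kappa>]
      unfolding cocycle_1_iff_additive[OF smult] cocycle_1_iff_additive[OF \<kappa>]
      by (simp add: r_distr)
  qed
  have "\<alpha> \<in> (\<lambda>c F x. c \<otimes> ?\<kappa> F x) ` carrier R" if "\<alpha> \<in> cocycles R ?L 1" for \<alpha>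
  proof (rule image_eqI)
    show "\<alpha> [{0}] (basis_vec R {{0}}) \<in> carrier R"
      using that by (intro cochain_closed[where n = 1 and L = ?L]) (simp add: cocycles_def)
  qed (rule partition_cocycle_eq[OF that])
  with multiple have "cocycles R ?L 1 = (\<lambda>c F x. c \<otimes> ?\<kappa> F x) ` carrier R" by blast
  moreover have "?\<kappa> [{0}] (basis_vec R {{0}}) = \<one>"
    by (simp add: cardinality_cochain_eq size_cochain_basis_vec decompositions_1
        partition_species_def partition_on_singleton)
  moreover have "coboundaries R ?L 1 = {\<lambda>F x. \<zero>}"
  proof -
    have "size_cochain ?P 0 (\<lambda>k. \<zero>) \<in> carrier (cochains R ?L 0)"
      by (intro size_cochain_closed cosymmetric_partition_species) simp
    then have "carrier (cochains R ?L 0) \<noteq> {}" by blast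
    then show ?thesis by (auto simp: coboundaries_def coboundary_0 image_constant_conv)
  qed
  ultimately show ?thesis
    by (intro cohomology_free_rank_one cochain_closed[OF \<kappa>])
qed

end

section \<open>Species whose Koszul complex lives in degrees zero and one\<close>

lemma order_rank_strict_mono:
  assumes "finite S" "s \<in> S" "t \<in> S" "s < t"
  shows "order_rank S s < order_rank S t"
  unfolding order_rank_def
proof (rule psubset_card_mono)
  have "t \<in> {u \<in> S. u \<le> t}" "t \<notin> {u \<in> S. u \<le> s}" using assms by simp_all
  moreover have "{u \<in> S. u \<le> s} \<subseteq> {u \<in> S. u \<le> t}" using assms by auto
  ultimately show "{u \<in> S. u \<le> s} \<subset> {u \<in> S. u \<le> t}" by blast
qed (use assms in simp)

lemma order_rank_bij_betw:
  assumes "finite S"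
  shows "bij_betw (order_rank S) S {1..card S}"
proof -
  have inj: "inj_on (order_rank S) S"
    using order_rank_strict_mono[OF assms] by (metis inj_onI less_irrefl linorder_less_linear)
  have "order_rank S s \<in> {1..card S}" if "s \<in> S" for s
  proof -
    have "{t \<in> S. t \<le> s} \<noteq> {}" using that by auto
    then have "order_rank S s > 0" using assms by (simp add: order_rank_def card_gt_0_iff)
    then show ?thesis using assms by (simp add: order_rank_def card_mono)
  qed
  then have "order_rank S ` S = {1..card S}"
    using card_image[OF inj] by (intro card_subset_eq) auto
  with inj show ?thesis by (simp add: bij_betw_def)
qed

lemma (in cosymmetric_set_species) standardized_res_closed:
  assumes "finite I" "S \<subseteq> I" "z \<in> ss_elems Y I"
  shows "standardized_res Y I S z \<in> ss_elems Y {1..card S}"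
proof -
  have "finite S" using assms finite_subset by blast
  with assms show ?thesis
    using map_closed[of S "order_rank S" "ss_res Y I S z"] res_closed[OF assms]
      order_rank_bij_betw[of S]
    by (simp add: standardized_res_def bij_betw_def)
qed

text \<open>The properties of partitions and of the exponential species on which the computation of the
  Koszul complex rests: at least one transposition fixes any given structure on two or more points,
  so that an alternating form must vanish on it, and the structures with at most one point are
  unique.\<close>

locale transposition_fixed_species =
  R?: cring R + cosymmetric_set_species Y
  for R :: "('k, 's) ring_scheme" (structure) and Y :: "'b set_species" +
  fixes u :: "nat \<Rightarrow> 'b"
  assumes two_torsion_free: "\<lbrakk>a \<in> carrier R; a \<oplus> a = \<zero>\<rbrakk> \<Longrightarrow> a = \<zero>"
    and small_elems: "p < 2 \<Longrightarrow> ss_elems Y {1..p} = {u p}"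
    and fixed_by_transposition: "\<lbrakk>2 \<le> p; z \<in> ss_elems Y {1..p}\<rbrakk>
      \<Longrightarrow> \<exists>i\<in>{1..p}. \<exists>j\<in>{1..p}. i \<noteq> j \<and> ss_map Y {1..p} (transpose i j) z = z"
begin

context
  notes One_nat_def [simp del]
begin

lemma koszul_linear: "f \<in> koszul R (linearize R Y) p \<Longrightarrow> linear_form R (free_module R (ss_elems Y {1..p})) f"
  by (simp add: koszul_def)

lemma koszul_outside:
  "f \<in> koszul R (linearize R Y) p \<Longrightarrow> x \<notin> carrier (free_module R (ss_elems Y {1..p})) \<Longrightarrow> f x = \<zero>"
  by (simp add: koszul_def)

lemma koszul_closed: "f \<in> koszul R (linearize R Y) p \<Longrightarrow> f x \<in> carrier R"
  using koszul_linear koszul_outside linear_form_closed by (metis zero_closed)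

lemma koszul_eqI:
  assumes f: "f \<in> koszul R (linearize R Y) p" and g: "g \<in> koszul R (linearize R Y) p"
    and eq: "\<And>z. z \<in> ss_elems Y {1..p} \<Longrightarrow> f (basis_vec R z) = g (basis_vec R z)"
  shows "f = g"
proof
  fix x show "f x = g x"
    using linear_form_eqI[OF koszul_linear[OF f] koszul_linear[OF g] eq]
      koszul_outside[OF f] koszul_outside[OF g]
    by (cases "x \<in> carrier (free_module R (ss_elems Y {1..p}))") simp_all
qed

lemma koszul_zero: "(\<lambda>x. \<zero>) \<in> koszul R (linearize R Y) p"
  by (simp add: koszul_def linear_form_def add_pow_int_ge add_pow_int_lt sign_def)

text \<open>Invariance under a transposition fixing \<open>z\<close> gives \<open>f z = - f z\<close>.\<close>

lemma koszul_vanishes: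
  assumes f: "f \<in> koszul R (linearize R Y) p" and p: "2 \<le> p"
  shows "f = (\<lambda>x. \<zero>)"
proof (rule koszul_eqI[OF f koszul_zero])
  fix z assume z: "z \<in> ss_elems Y {1..p}"
  obtain i j where ij: "i \<in> {1..p}" "j \<in> {1..p}" "i \<noteq> j"
    and fixed: "ss_map Y {1..p} (transpose i j) z = z"
    using fixed_by_transposition[OF p z] by blast
  have cl: "f (basis_vec R z) \<in> carrier R" by (rule koszul_closed[OF f])
  have "transpose i j permutes {1..p}" using ij by (intro permutes_swap_id)
  then have "f (lin_push R (ss_map Y {1..p} (transpose i j)) (basis_vec R z))
      = [sign (transpose i j)] \<cdot> f (basis_vec R z)"
    using f z by (simp add: koszul_def basis_vec_closed)
  then have "f (basis_vec R z) = \<ominus> f (basis_vec R z)"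
    using ij cl by (simp add: lin_push_basis_vec fixed sign_swap_id add_pow_int_lt)
  then have "f (basis_vec R z) \<oplus> f (basis_vec R z) = \<zero>"
    using cl r_neg by metis
  then show "f (basis_vec R z) = \<zero>" by (rule two_torsion_free[OF cl])
qed

definition point_form :: "nat \<Rightarrow> 'k \<Rightarrow> ('b \<Rightarrow> 'k) \<Rightarrow> 'k" where
  "point_form p c x = (if x \<in> carrier (free_module R (ss_elems Y {1..p})) then c \<otimes> x (u p) else \<zero>)"

lemma point_form_closed: "c \<in> carrier R \<Longrightarrow> point_form p c x \<in> carrier R"
  using free_module_value[of x _ "u p"] by (simp add: point_form_def)

lemma point_form_add:
  "\<lbrakk>c \<in> carrier R; d \<in> carrier R\<rbrakk> \<Longrightarrow> point_form p c x \<oplus> point_form p d x = point_form p (c \<oplus> d) x"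
  using free_module_value[of x _ "u p"] by (simp add: point_form_def l_distr)

lemma point_form_smult:
  "\<lbrakk>c \<in> carrier R; d \<in> carrier R\<rbrakk> \<Longrightarrow> c \<otimes> point_form p d x = point_form p (c \<otimes> d) x"
  using free_module_value[of x _ "u p"] by (simp add: point_form_def m_assoc)

lemma point_form_zero: "point_form p \<zero> x = \<zero>"
  using free_module_value[of x _ "u p"] by (simp add: point_form_def)

lemma point_form_koszul:
  assumes p: "p < 2" and c: "c \<in> carrier R"
  shows "point_form p c \<in> koszul R (linearize R Y) p"
proof -
  have lin: "linear_form R (free_module R (ss_elems Y {1..p})) (point_form p c)"
    using c point_form_closed[OF c] free_module_value[of _ "ss_elems Y {1..p}" "u p"]
    by (simp add: linear_form_def Pi_iff)
      (simp add: point_form_def free_module_add_closed free_module_smult_closed r_distr m_lcomm)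
  have inv: "point_form p c (lin_push R (ss_map Y {1..p} \<sigma>) x) = [sign \<sigma>] \<cdot> point_form p c x"
    if perm: "\<sigma> permutes {1..p}" and x: "x \<in> carrier (free_module R (ss_elems Y {1..p}))" for \<sigma> x
  proof -
    have "{1..p} = {} \<or> {1..p} = {1}" using p by auto
    with perm have id: "\<sigma> = id" by (auto simp: permutes_sing)
    have u: "u p \<in> ss_elems Y {1..p}" using small_elems[OF p] by simp
    then have fixed: "ss_map Y {1..p} id (u p) = u p" by (intro map_id) simp
    have x': "x \<in> carrier (free_module R {u p})" using x small_elems[OF p] by simp
    have "lin_push R (ss_map Y {1..p} id) x (u p) = x (u p)"
      using free_module_value[OF x]
      by (simp add: lin_push_eq_lin_ext[OF x'] lin_ext_singleton[OF x'] fixed basis_vec_def)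
    moreover have "lin_push R (ss_map Y {1..p} id) x \<in> carrier (free_module R (ss_elems Y {1..p}))"
      using map_closed[of "{1..p}" id] by (intro lin_push_closed[OF x]) auto
    ultimately show ?thesis
      using x c free_module_value[OF x] by (simp add: point_form_def id sign_id add_pow_int_ge)
  qed
  show ?thesis
    using lin inv by (simp add: koszul_def) (simp add: point_form_def)
qed

lemma point_form_basis_vec: "p < 2 \<Longrightarrow> c \<in> carrier R \<Longrightarrow> point_form p c (basis_vec R (u p)) = c"
  using small_elems[of p] by (simp add: point_form_def basis_vec_closed) (simp add: basis_vec_def)

lemma koszul_eq_point_form:
  assumes "f \<in> koszul R (linearize R Y) p" "p < 2"
  shows "f = point_form p (f (basis_vec R (u p)))"
  using assms small_elems[of p]
  by (intro koszul_eqI[OF assms(1)] point_form_koszul koszul_closed[OF assms(1)])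
    (auto simp: point_form_basis_vec koszul_closed)

subsection \<open>The product\<close>

text \<open>With at most one point in total there is a single decomposition of the required sizes, and it
  has no inversions.\<close>

lemma smile_point:
  assumes f: "f \<in> koszul R (linearize R Y) p" and g: "g \<in> koszul R (linearize R Y) q" and pq: "p + q < 2"
  shows "smile R Y p q f g = point_form (p + q) (f (basis_vec R (u p)) \<otimes> g (basis_vec R (u q)))"
proof
  fix x
  let ?I = "{1..p + q}" and ?c = "f (basis_vec R (u p)) \<otimes> g (basis_vec R (u q))"
  have sets: "{S. S \<subseteq> ?I \<and> card S = p} = {{1..p}}"
  proof (cases "p = 0")
    case True
    then show ?thesis by (auto dest: finite_subset[OF _ finite_atLeastAtMost])
  next
    case False
    then have "p = 1" "q = 0" using pq by auto
    then show ?thesis by (auto dest: subset_singletonD)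
  qed
  have compl: "card (?I - {1..p}) = q" by (subst card_Diff_subset) auto
  have no_inversions: "sch {1..p} (?I - {1..p}) = 0" by (auto simp: sch_def intro!: card_eq_0_iff[THEN iffD2])
  have z: "u (p + q) \<in> ss_elems Y ?I" using small_elems[OF pq] by simp
  have "standardized_res Y ?I {1..p} (u (p + q)) = u p"
    using standardized_res_closed[OF _ _ z, of "{1..p}"] small_elems[of p] pq by simp
  moreover have "standardized_res Y ?I (?I - {1..p}) (u (p + q)) = u q"
    using standardized_res_closed[OF _ _ z, of "?I - {1..p}"] small_elems[of q] pq compl by simp
  moreover have "?c \<in> carrier R" using koszul_closed[OF f] koszul_closed[OF g] by simp
  ultimately have inner: "(\<Oplus>S\<in>{S. S \<subseteq> ?I \<and> card S = p}. ((\<ominus> \<one>) [^] sch S (?I - S)) \<otimes>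
      (f (basis_vec R (standardized_res Y ?I S (u (p + q)))) \<otimes>
       g (basis_vec R (standardized_res Y ?I (?I - S) (u (p + q)))))) = ?c"
    unfolding sets by (simp add: no_inversions)
  show "smile R Y p q f g x = point_form (p + q) ?c x"
  proof (cases "x \<in> carrier (free_module R (ss_elems Y ?I))")
    case True
    then have x: "x \<in> carrier (free_module R {u (p + q)})" using small_elems[OF pq] by simp
    show ?thesis
      using True koszul_closed[OF f] koszul_closed[OF g] free_module_value[OF x] inner
      by (simp add: smile_def Let_def lin_ext_singleton[OF x] point_form_def m_comm)
  qed (simp add: smile_def Let_def point_form_def)
qed

text \<open>If the degrees are not both one, a factor is zero. If they are, the two decompositions of
  \<open>{1, 2}\<close> into points give the same term with opposite signs.\<close>

lemma smile_vanishes: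
  assumes f: "f \<in> koszul R (linearize R Y) p" and g: "g \<in> koszul R (linearize R Y) q" and pq: "2 \<le> p + q"
  shows "smile R Y p q f g = (\<lambda>x. \<zero>)"
proof
  fix x
  let ?I = "{1..p + q}"
  let ?t = "\<lambda>z S. ((\<ominus> \<one>) [^] sch S (?I - S)) \<otimes> (f (basis_vec R (standardized_res Y ?I S z)) \<otimes>
       g (basis_vec R (standardized_res Y ?I (?I - S) z)))"
  have inner: "(\<Oplus>S\<in>{S. S \<subseteq> ?I \<and> card S = p}. ?t z S) = \<zero>" if z: "z \<in> ss_elems Y ?I" for z
  proof (cases "p = 1 \<and> q = 1")
    case False
    then have "2 \<le> p \<or> 2 \<le> q" using pq by auto
    then have "f = (\<lambda>x. \<zero>) \<or> g = (\<lambda>x. \<zero>)"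
      using koszul_vanishes[OF f] koszul_vanishes[OF g] by blast
    then have "?t z S = \<zero>" for S using koszul_closed[OF f] koszul_closed[OF g] by auto
    then show ?thesis by simp
  next
    case True
    then have I: "?I = {1, 2}" and p: "p = 1" and q: "q = 1" by auto
    have sets: "{S. S \<subseteq> {1, 2} \<and> card S = 1} = {{1}, {2::nat}}"
      by (auto elim!: card_1_singletonE)
    have "{(s, t). s \<in> {1} \<and> t \<in> {2} \<and> t < s} = ({} :: (nat \<times> nat) set)" by auto
    then have sch12: "sch {1} {2} = 0" by (simp only: sch_def card.empty)
    have "{(s, t). s \<in> {2} \<and> t \<in> {1} \<and> t < s} = {(2::nat, 1::nat)}" by auto
    then have sch21: "sch {2} {1} = 1" by (simp only: sch_def) simp
    have std: "standardized_res Y ?I S z = u 1" if "S \<subseteq> ?I" "card S = 1" for S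
      using standardized_res_closed[OF _ that(1) z] small_elems[of 1] that(2) by simp
    have std1: "standardized_res Y {1, 2} {1} z = u 1" "standardized_res Y {1, 2} {2} z = u 1"
      using std[of "{1}"] std[of "{2}"] unfolding I by auto
    have diff: "{1, 2} - {1} = {2::nat}" "{1, 2} - {2} = {1::nat}" by auto
    have "f (basis_vec R (u 1)) \<otimes> g (basis_vec R (u 1)) \<in> carrier R"
      using koszul_closed[OF f] koszul_closed[OF g] by simp
    then show ?thesis
      unfolding I unfolding p sets
      by (simp add: diff std1 sch12 sch21 l_minus r_neg)
  qed
  show "smile R Y p q f g x = \<zero>"
  proof (cases "x \<in> carrier (free_module R (ss_elems Y ?I))")
    case True
    have "smile R Y p q f g x = lin_ext R (\<lambda>z. \<zero>) x"
      unfolding smile_def Let_def if_P[OF True] by (rule lin_ext_cong[OF True inner]) simp_all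
    also have "\<dots> = \<zero>"
      using free_module_value[OF True] by (simp add: lin_ext_def)
    finally show ?thesis .
  qed (simp add: smile_def Let_def)
qed

lemma graded_commutative_species: "graded_commutative R Y"
  unfolding graded_commutative_def
proof (intro allI ballI)
  fix p q f g
  assume f: "f \<in> koszul R (linearize R Y) p" and g: "g \<in> koszul R (linearize R Y) q"
  show "smile R Y p q f g = (\<lambda>x. ((\<ominus> \<one>) [^] (p * q)) \<otimes> smile R Y q p g f x)"
  proof (cases "p + q < 2")
    case True
    then have "p * q = 0" by (cases p) auto
    then have "(\<ominus> \<one>) [^] (p * q) = \<one>" by (simp only: nat_pow_0)
    moreover have "g (basis_vec R (u q)) \<otimes> f (basis_vec R (u p)) \<in> carrier R"
      using koszul_closed[OF f] koszul_closed[OF g] by simp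
    ultimately show ?thesis
      using True koszul_closed[OF f] koszul_closed[OF g]
      by (simp add: smile_point[OF f g] smile_point[OF g f] point_form_closed add.commute m_comm)
  next
    case False
    then show ?thesis by (simp add: smile_vanishes[OF f g] smile_vanishes[OF g f])
  qed
qed

subsection \<open>The Koszul algebra\<close>

text \<open>The element \<open>a + b \<epsilon>\<close> of the algebra of dual numbers over \<open>R\<close>, where \<open>\<epsilon>\<close> is the form of
  degree one with value \<open>\<one>\<close> on the structure on one point.\<close>

definition koszul_elt :: "'k \<Rightarrow> 'k \<Rightarrow> nat \<Rightarrow> ('b \<Rightarrow> 'k) \<Rightarrow> 'k" where
  "koszul_elt a b p = (if p = 0 then point_form 0 a else if p = 1 then point_form 1 b else (\<lambda>x. \<zero>))"

lemma koszul_elt_koszul: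
  "a \<in> carrier R \<Longrightarrow> b \<in> carrier R \<Longrightarrow> koszul_elt a b p \<in> koszul R (linearize R Y) p"
  using point_form_koszul[of 0 a] point_form_koszul[of 1 b] koszul_zero
  by (simp add: koszul_elt_def)

lemma koszul_elt_0: "a \<in> carrier R \<Longrightarrow> koszul_elt a b 0 (basis_vec R (u 0)) = a"
  and koszul_elt_1: "b \<in> carrier R \<Longrightarrow> koszul_elt a b 1 (basis_vec R (u 1)) = b"
  using point_form_basis_vec[of 0 a] point_form_basis_vec[of 1 b] by (simp_all add: koszul_elt_def)

lemma koszul_elt_inject:
  assumes "a \<in> carrier R" "b \<in> carrier R" "c \<in> carrier R" "d \<in> carrier R"
  shows "koszul_elt a b = koszul_elt c d \<longleftrightarrow> a = c \<and> b = d"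
  using koszul_elt_0 koszul_elt_1 assms by metis

lemma koszul_algebra_carrier:
  "carrier (koszul_algebra R Y) = (\<lambda>(a, b). koszul_elt a b) ` (carrier R \<times> carrier R)"
proof (intro subset_antisym subsetI)
  fix f assume "f \<in> carrier (koszul_algebra R Y)"
  then have f: "f p \<in> koszul R (linearize R Y) p" for p by (simp add: koszul_algebra_def)
  define a b where "a = f 0 (basis_vec R (u 0))" and "b = f 1 (basis_vec R (u 1))"
  have "f 0 = point_form 0 a" "f 1 = point_form 1 b"
    unfolding a_def b_def by (rule koszul_eq_point_form[OF f], simp)+
  moreover have "f p = (\<lambda>x. \<zero>)" if "2 \<le> p" for p using koszul_vanishes[OF f that] .
  ultimately have "f = koszul_elt a b" by (auto simp: fun_eq_iff koszul_elt_def)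
  moreover have "a \<in> carrier R" "b \<in> carrier R"
    unfolding a_def b_def by (rule koszul_closed[OF f])+
  ultimately show "f \<in> (\<lambda>(a, b). koszul_elt a b) ` (carrier R \<times> carrier R)" by auto
next
  fix f assume "f \<in> (\<lambda>(a, b). koszul_elt a b) ` (carrier R \<times> carrier R)"
  then obtain a b where ab: "a \<in> carrier R" "b \<in> carrier R" and f: "f = koszul_elt a b" by auto
  have "{p. f p \<noteq> (\<lambda>x. \<zero>)} \<subseteq> {0, 1}" by (auto simp: f koszul_elt_def)
  then have "finite {p. f p \<noteq> (\<lambda>x. \<zero>)}" by (rule finite_subset) simp
  then show "f \<in> carrier (koszul_algebra R Y)"
    using koszul_elt_koszul[OF ab] by (simp add: koszul_algebra_def f)
qed

lemma koszul_elt_closed: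
  "a \<in> carrier R \<Longrightarrow> b \<in> carrier R \<Longrightarrow> koszul_elt a b \<in> carrier (koszul_algebra R Y)"
  by (force simp: koszul_algebra_carrier)

lemma koszul_algebra_cases:
  assumes "f \<in> carrier (koszul_algebra R Y)"
  obtains a b where "a \<in> carrier R" "b \<in> carrier R" "f = koszul_elt a b"
  using assms by (auto simp: koszul_algebra_carrier)

lemma koszul_elt_add:
  assumes "a \<in> carrier R" "b \<in> carrier R" "c \<in> carrier R" "d \<in> carrier R"
  shows "koszul_elt a b \<oplus>\<^bsub>koszul_algebra R Y\<^esub> koszul_elt c d = koszul_elt (a \<oplus> c) (b \<oplus> d)"
  using assms by (auto simp: fun_eq_iff koszul_algebra_def koszul_elt_def point_form_add)

lemma koszul_elt_smult:
  assumes "a \<in> carrier R" "b \<in> carrier R" "c \<in> carrier R"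
  shows "c \<odot>\<^bsub>koszul_algebra R Y\<^esub> koszul_elt a b = koszul_elt (c \<otimes> a) (c \<otimes> b)"
  using assms by (auto simp: fun_eq_iff koszul_algebra_def koszul_elt_def point_form_smult)

lemma koszul_elt_zero: "\<zero>\<^bsub>koszul_algebra R Y\<^esub> = koszul_elt \<zero> \<zero>"
  by (auto simp: fun_eq_iff koszul_algebra_def koszul_elt_def point_form_zero)

lemma koszul_elt_one: "\<one>\<^bsub>koszul_algebra R Y\<^esub> = koszul_elt \<one> \<zero>"
proof (intro ext)
  fix p x
  have elems: "ss_elems Y {} = {u 0}" using small_elems[of 0] by simp
  show "\<one>\<^bsub>koszul_algebra R Y\<^esub> p x = koszul_elt \<one> \<zero> p x"
    using free_module_value[of x "{u 0}" "u 0"]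
    by (simp add: koszul_algebra_def koszul_elt_def point_form_zero)
      (simp add: point_form_def elems lin_ext_singleton)
qed

lemma koszul_elt_mult:
  assumes ab: "a \<in> carrier R" "b \<in> carrier R" and cd: "c \<in> carrier R" "d \<in> carrier R"
  shows "koszul_elt a b \<otimes>\<^bsub>koszul_algebra R Y\<^esub> koszul_elt c d = koszul_elt (a \<otimes> c) (a \<otimes> d \<oplus> b \<otimes> c)"
proof (intro ext)
  fix n x
  let ?s = "\<lambda>p. smile R Y p (n - p) (koszul_elt a b p) (koszul_elt c d (n - p)) x"
  have mult: "(koszul_elt a b \<otimes>\<^bsub>koszul_algebra R Y\<^esub> koszul_elt c d) n x = (\<Oplus>p\<in>{0..n}. ?s p)"
    by (simp add: koszul_algebra_def)
  note point = smile_point[OF koszul_elt_koszul[OF ab] koszul_elt_koszul[OF cd]]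
  note cl = point_form_closed[of _ _ x]
  consider "n = 0" | "n = 1" | "2 \<le> n" by linarith
  then show "(koszul_elt a b \<otimes>\<^bsub>koszul_algebra R Y\<^esub> koszul_elt c d) n x
      = koszul_elt (a \<otimes> c) (a \<otimes> d \<oplus> b \<otimes> c) n x"
  proof cases
    case 1
    then have "?s 0 = point_form 0 (a \<otimes> c) x"
      using point[of 0 0] ab cd by (simp add: koszul_elt_0)
    then show ?thesis unfolding mult using 1 ab cd cl by (simp add: koszul_elt_def)
  next
    case 2
    have "point_form 1 (a \<otimes> d) x \<oplus> point_form 1 (b \<otimes> c) x = point_form 1 (a \<otimes> d \<oplus> b \<otimes> c) x"
      using ab cd by (simp add: point_form_add)
    moreover have s: "?s 0 = point_form 1 (a \<otimes> d) x" "?s 1 = point_form 1 (b \<otimes> c) x"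
      using 2 point[of 0 1] point[of 1 0] ab cd by (simp_all add: koszul_elt_0 koszul_elt_1)
    moreover have "(\<Oplus>p\<in>{0..n}. ?s p) = ?s 1 \<oplus> ?s 0"
    proof -
      have "{0..n} = {0, 1}" using 2 by auto
      moreover have "?s 0 \<in> carrier R" "?s 1 \<in> carrier R"
        unfolding s using cl ab cd by simp_all
      ultimately show ?thesis by (simp add: a_comm)
    qed
    ultimately show ?thesis
      unfolding mult using 2 cl ab cd by (simp add: koszul_elt_def a_comm)
  next
    case 3
    have "?s p = \<zero>" if "p \<in> {0..n}" for p
      using that 3 smile_vanishes[OF koszul_elt_koszul[OF ab] koszul_elt_koszul[OF cd], of p "n - p"]
      by simp
    then have "(\<Oplus>p\<in>{0..n}. ?s p) = \<zero>" by (intro add.finprod_one_eqI)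
    then show ?thesis unfolding mult using 3 by (simp add: koszul_elt_def)
  qed
qed

text \<open>In the coordinates \<open>a\<close> and \<open>b\<close> the axioms are identities in \<open>R\<close>.\<close>

lemma koszul_algebra_is_algebra: "algebra R (koszul_algebra R Y)"
proof -
  note elt = koszul_elt_closed koszul_elt_add koszul_elt_smult koszul_elt_zero koszul_elt_one
    koszul_elt_mult
  have "abelian_group (koszul_algebra R Y)"
  proof (rule abelian_groupI)
    fix x assume "x \<in> carrier (koszul_algebra R Y)"
    then obtain a b where "a \<in> carrier R" "b \<in> carrier R" "x = koszul_elt a b"
      by (rule koszul_algebra_cases)
    then show "\<exists>y\<in>carrier (koszul_algebra R Y). y \<oplus>\<^bsub>koszul_algebra R Y\<^esub> x = \<zero>\<^bsub>koszul_algebra R Y\<^esub>"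
      by (intro bexI[of _ "koszul_elt (\<ominus> a) (\<ominus> b)"]) (simp_all add: elt l_neg)
  qed (auto elim!: koszul_algebra_cases simp: elt a_ac)
  moreover have "comm_monoid (koszul_algebra R Y)"
    by (rule comm_monoidI)
      (auto elim!: koszul_algebra_cases simp: elt l_distr r_distr m_ac a_ac)
  ultimately have "cring (koszul_algebra R Y)"
    by (rule cringI) (auto elim!: koszul_algebra_cases simp: elt l_distr a_ac)
  then show ?thesis
    by (intro algebraI R.is_cring)
      (auto elim!: koszul_algebra_cases simp: elt l_distr r_distr m_ac)
qed

end

end

section \<open>Partitions and the exponential species\<close>

context
  notes One_nat_def [simp del]
begin

lemma transposition_fixed_exp:
  assumes "cring K" "\<And>a. \<lbrakk>a \<in> carrier K; a \<oplus>\<^bsub>K\<^esub> a = \<zero>\<^bsub>K\<^esub>\<rbrakk> \<Longrightarrow> a = \<zero>\<^bsub>K\<^esub>"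
  shows "transposition_fixed_species K exp_species (\<lambda>p. ())"
proof -
  interpret cring K by fact
  interpret cosymmetric_set_species exp_species by (rule cosymmetric_exp_species)
  show ?thesis
  proof
    fix p :: nat and z :: unit assume "2 \<le> p"
    then have "1 \<in> {1..p}" "2 \<in> {1..p}" "(1::nat) \<noteq> 2" by auto
    then show "\<exists>i\<in>{1..p}. \<exists>j\<in>{1..p}. i \<noteq> j \<and> ss_map exp_species {1..p} (transpose i j) z = z"
      by (intro bexI[of _ 1] bexI[of _ 2]) simp_all
  next
    show "ss_elems exp_species {1..p} = {()}" for p
      by (simp add: exp_species_def UNIV_unit)
  qed (rule assms(2))
qed

text \<open>Two points of a common block may be exchanged; if there are no such points, all blocks are
  singletons and any two points may be exchanged.\<close>

lemma partition_fixed_by_transposition: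
  assumes z: "partition_on I z" and ab: "a \<in> I" "b \<in> I" "a \<noteq> b"
  obtains i j where "i \<in> I" "j \<in> I" "i \<noteq> j" "(`) (transpose i j) ` z = z"
proof (cases "\<exists>x\<in>z. \<exists>i\<in>x. \<exists>j\<in>x. i \<noteq> j")
  case True
  then obtain x i j where x: "x \<in> z" "i \<in> x" "j \<in> x" and ij: "i \<noteq> j" by blast
  have "transpose i j ` y = y" if y: "y \<in> z" for y
  proof -
    have "i \<in> y \<longleftrightarrow> j \<in> y"
      using z x y unfolding partition_on_def disjoint_def by blast
    then show ?thesis by (rule transpose_image_eq)
  qed
  then have "(`) (transpose i j) ` z = z" by simp
  moreover have "i \<in> I" "j \<in> I" using z x by (auto simp: partition_on_def)
  ultimately show ?thesis using ij that by blast
next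
  case False
  have "z = (\<lambda>i. {i}) ` I"
  proof (intro subset_antisym subsetI)
    fix x assume x: "x \<in> z"
    then have "x \<noteq> {}" "x \<subseteq> I" using z by (auto simp: partition_on_def)
    then obtain i where "i \<in> x" "i \<in> I" by blast
    from False x this(1) have "x = {i}" by blast
    then show "x \<in> (\<lambda>i. {i}) ` I" using \<open>i \<in> I\<close> by simp
  next
    fix x assume "x \<in> (\<lambda>i. {i}) ` I"
    then obtain i where i: "i \<in> I" "x = {i}" by auto
    then obtain y where "y \<in> z" "i \<in> y" using z by (auto simp: partition_on_def)
    with False have "y = {i}" by auto
    with \<open>y \<in> z\<close> i show "x \<in> z" by simp
  qed
  moreover have "transpose a b ` I = I" using ab by (simp add: transpose_image_eq)
  ultimately have "(`) (transpose a b) ` z = z"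
    by (metis (no_types, lifting) image_cong image_empty image_image image_insert)
  then show ?thesis using ab that by blast
qed

lemma one_block_small_elems:
  assumes "p < 2"
  shows "{z. partition_on {1..p} z} = {one_block {1..p} ()}"
proof -
  have "p = 0 \<or> p = 1" using assms by auto
  then show ?thesis
    by (auto simp: one_block_def partition_on_singleton) (auto simp: partition_on_def)
qed

lemma transposition_fixed_partition:
  assumes "cring K" "\<And>a. \<lbrakk>a \<in> carrier K; a \<oplus>\<^bsub>K\<^esub> a = \<zero>\<^bsub>K\<^esub>\<rbrakk> \<Longrightarrow> a = \<zero>\<^bsub>K\<^esub>"
  shows "transposition_fixed_species K partition_species (\<lambda>p. one_block {1..p} ())"
proof -
  interpret cring K by fact
  interpret cosymmetric_set_species partition_species by (rule cosymmetric_partition_species)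
  show ?thesis
  proof
    fix p z assume p: "2 \<le> p" and z: "z \<in> ss_elems partition_species {1..p}"
    have "1 \<in> {1..p}" "2 \<in> {1..p}" "(1::nat) \<noteq> 2" using p by auto
    then obtain i j where "i \<in> {1..p}" "j \<in> {1..p}" "i \<noteq> j" "(`) (transpose i j) ` z = z"
      using partition_fixed_by_transposition[of "{1..p}" z 1 2] z
      unfolding partition_species_def by (metis mem_Collect_eq set_species.select_convs(1))
    then show "\<exists>i\<in>{1..p}. \<exists>j\<in>{1..p}. i \<noteq> j \<and> ss_map partition_species {1..p} (transpose i j) z = z"
      unfolding partition_species_def by (metis set_species.select_convs(2))
  next
    fix p :: nat assume "p < 2"
    then show "ss_elems partition_species {1..p} = {one_block {1..p} ()}"
      by (simp only: partition_species_def set_species.simps one_block_small_elems)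
  qed (rule assms(2))
qed

text \<open>The distinguished structures on at most one point correspond under the inclusion, so the induced
  map preserves the coordinates of dual numbers.\<close>

lemma koszul_pullback_one_block_iso:
  assumes K: "cring K" and two: "\<And>a. \<lbrakk>a \<in> carrier K; a \<oplus>\<^bsub>K\<^esub> a = \<zero>\<^bsub>K\<^esub>\<rbrakk> \<Longrightarrow> a = \<zero>\<^bsub>K\<^esub>"
  shows "comm_algebra_iso K (koszul_algebra K partition_species) (koszul_algebra K exp_species)
           (koszul_pullback K exp_species one_block)"
proof -
  interpret P: transposition_fixed_species K partition_species "\<lambda>p. one_block {1..p} ()"
    using K two by (rule transposition_fixed_partition)
  interpret E: transposition_fixed_species K exp_species "\<lambda>p. ()"
    using K two by (rule transposition_fixed_exp)
  let ?A = "koszul_algebra K partition_species" and ?B = "koszul_algebra K exp_species"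
  let ?h = "koszul_pullback K exp_species one_block"
  have h: "?h (P.koszul_elt a b) = E.koszul_elt a b"
    if ab: "a \<in> carrier K" "b \<in> carrier K" for a b
  proof (intro ext)
    fix p :: nat and x
    have point: "koszul_pullback K exp_species one_block (\<lambda>_. P.point_form p c) p x = E.point_form p c x"
      if p: "p < 2" and c: "c \<in> carrier K" for p c x
    proof (cases "x \<in> carrier (free_module K (ss_elems exp_species {1..p}))")
      case True
      have u: "one_block {1..p} () \<in> ss_elems partition_species {1..p}"
        using P.small_elems[OF p] by simp
      have x: "x \<in> carrier (free_module K {()})" using True by (simp add: exp_species_def UNIV_unit)
      have closed: "lin_push K (one_block {1..p}) x \<in> carrier (free_module K (ss_elems partition_species {1..p}))"
        using u by (intro P.lin_push_closed[OF x]) simp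
      have "lin_push K (one_block {1..p}) x (one_block {1..p} ()) = x ()"
        using P.free_module_value[OF x]
        by (simp add: P.lin_push_eq_lin_ext[OF x] P.lin_ext_singleton[OF x] basis_vec_def)
      then show ?thesis
        using True closed by (simp add: koszul_pullback_def P.point_form_def E.point_form_def)
    qed (simp add: koszul_pullback_def E.point_form_def)
    have degreewise: "?h f p x = ?h (\<lambda>_. f p) p x" for f
      by (simp add: koszul_pullback_def)
    show "?h (P.koszul_elt a b) p x = E.koszul_elt a b p x"
    proof (cases "p < 2")
      case True
      then have "p = 0 \<or> p = 1" by auto
      then obtain c where "c \<in> carrier K" "P.koszul_elt a b p = P.point_form p c"
        "E.koszul_elt a b p = E.point_form p c"
        using ab by (auto simp: P.koszul_elt_def E.koszul_elt_def)
      then show ?thesis using point[OF True] degreewise[of "P.koszul_elt a b"] by simp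
    next
      case False
      then show ?thesis by (simp add: koszul_pullback_def P.koszul_elt_def E.koszul_elt_def)
    qed
  qed
  have "?h \<in> ring_hom ?A ?B"
    by (rule ring_hom_memI)
      (auto elim!: P.koszul_algebra_cases simp: h E.koszul_elt_closed P.koszul_elt_add E.koszul_elt_add
        P.koszul_elt_mult E.koszul_elt_mult P.koszul_elt_one E.koszul_elt_one)
  moreover have "bij_betw ?h (carrier ?A) (carrier ?B)"
    unfolding bij_betw_def
  proof
    show "inj_on ?h (carrier ?A)"
      by (rule inj_onI) (auto elim!: P.koszul_algebra_cases simp: h E.koszul_elt_inject)
    show "?h ` carrier ?A = carrier ?B"
      by (force simp: P.koszul_algebra_carrier E.koszul_algebra_carrier h image_image)
  qed
  moreover have "?h (c \<odot>\<^bsub>?A\<^esub> f) = c \<odot>\<^bsub>?B\<^esub> ?h f" if "c \<in> carrier K" "f \<in> carrier ?A" for c f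
    using that by (auto elim!: P.koszul_algebra_cases simp: h P.koszul_elt_smult E.koszul_elt_smult)
  ultimately show ?thesis
    using P.koszul_algebra_is_algebra E.koszul_algebra_is_algebra
    by (simp add: comm_algebra_iso_def ring_iso_def)
qed

end

theorem proposition3p6:
  fixes K :: "('k, 's) ring_scheme"
  assumes "cring K" and "ring_char K \<noteq> 2"
  shows "(\<exists>g. free_rank_one_on K (cohomology K (linearize K partition_species) 0) g)
    \<and> cardinality_cochain K \<in> cocycles K (linearize K partition_species) 1
    \<and> free_rank_one_on K (cohomology K (linearize K partition_species) 1)
        (cohomology_class K (linearize K partition_species) 1 (cardinality_cochain K))
    \<and> ((\<forall>a\<in>carrier K. a \<oplus>\<^bsub>K\<^esub> a = \<zero>\<^bsub>K\<^esub> \<longrightarrow> a = \<zero>\<^bsub>K\<^esub>) \<longrightarrow>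
         comm_algebra_iso K (koszul_algebra K partition_species) (koszul_algebra K exp_species)
           (koszul_pullback K exp_species one_block)
         \<and> graded_commutative K partition_species
         \<and> graded_commutative K exp_species)"
proof -
  interpret cring K by fact
  have "comm_algebra_iso K (koszul_algebra K partition_species) (koszul_algebra K exp_species)
      (koszul_pullback K exp_species one_block)
    \<and> graded_commutative K partition_species \<and> graded_commutative K exp_species"
    if two: "\<forall>a\<in>carrier K. a \<oplus>\<^bsub>K\<^esub> a = \<zero>\<^bsub>K\<^esub> \<longrightarrow> a = \<zero>\<^bsub>K\<^esub>"
  proof -
    have two': "\<And>a. \<lbrakk>a \<in> carrier K; a \<oplus>\<^bsub>K\<^esub> a = \<zero>\<^bsub>K\<^esub>\<rbrakk> \<Longrightarrow> a = \<zero>\<^bsub>K\<^esub>" using two by blast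
    interpret P: transposition_fixed_species K partition_species "\<lambda>p. one_block {1..p} ()"
      using assms(1) two' by (rule transposition_fixed_partition)
    interpret E: transposition_fixed_species K exp_species "\<lambda>p. ()"
      using assms(1) two' by (rule transposition_fixed_exp)
    show ?thesis
      using koszul_pullback_one_block_iso[OF assms(1) two'] P.graded_commutative_species E.graded_commutative_species
      by blast
  qed
  then show ?thesis
    using cohomology_0_partitions cardinality_cocycle cohomology_1_partitions by blast
qed

end
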